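(* Let $n\ge 2$ be an integer, let $2<p<\infty$, and let $L\subset\mathbb{R}^n$ be the unit ball of an $n$-dimensional subspace of $L_p$. Then for every measure $\mu$ with even continuous non-negative density in $\mathbb{R}^n$, $$\mu(L)\ \le\ n^{1/2-1/p}\, \frac{n}{n-1}\, c_n\, \max_{\xi\in S^{n-1}} \mu(L\cap\xi^\perp)\ |L|^{1/n},$$ where $c_n=|B_2^n|^{\frac{n-1}{n}}/|B_2^{n-1}|$.
   Context: Notation: $|\cdot|$ denotes volume of the appropriate dimension; $B_2^j$ is the unit Euclidean ball in $\mathbb{R}^j$; for $\xi\in S^{n-1}$, $\xi^\perp$ is the central hyperplane in $\mathbb{R}^n$ perpendicular to $\xi$. Measures: if $\mu$ has even continuous non-negative density $f$ on $\mathbb{R}^n$, then $\mu(B)=\int_B f(x)\,dx$ for compact $B\subset\mathbb{R}^n$, and $\mu(L\cap\xi^\perp)=\int_{L\cap\xi^\perp} f$, the integral being with respect to $(n-1)$-dimensional Lebesgue measure on $\xi^\perp$. Subspaces of $L_p$: $L=\{x\in\mathbb{R}^n:\|x\|\le 1\}$ is the unit ball of an $n$-dimensional subspace of $L_p$ if $\|\cdot\|$ is a norm on $\mathbb{R}^n$ such that $(\mathbb{R}^n,\|\cdot\|)$ embeds isometrically in $L_p([0,1])$; equivalently, there is a finite Borel measure $\nu$ on $S^{n-1}$ with $\|x\|^p=\int_{S^{n-1}}|(x,\xi)|^p\,d\nu(\xi)$ for all $x\in\mathbb{R}^n$, where $(\cdot,\cdot)$ is the standard inner product. *)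

theory Defs
  imports "HOL-Analysis.Analysis"
begin

definition is_norm :: "('a::real_vector \<Rightarrow> real) \<Rightarrow> bool" where
  "is_norm N \<longleftrightarrow>
     (\<forall>x. N x = 0 \<longleftrightarrow> x = 0) \<and>
     (\<forall>a x. N (a *\<^sub>R x) = \<bar>a\<bar> * N x) \<and>
     (\<forall>x y. N (x + y) \<le> N x + N y)"

text \<open>Elements of \<open>L\<^sub>p([0,1])\<close> are represented by functions; equality in \<open>L\<^sub>p\<close> is equality
  almost everywhere on \<open>[0,1]\<close>.\<close>

definition Lp01 :: "real \<Rightarrow> (real \<Rightarrow> real) set" where
  "Lp01 p = {g. g \<in> borel_measurable (lebesgue_on {0..1}) \<and>
                integrable (lebesgue_on {0..1}) (\<lambda>t. \<bar>g t\<bar> powr p)}"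

definition Lp01_norm :: "real \<Rightarrow> (real \<Rightarrow> real) \<Rightarrow> real" where
  "Lp01_norm p g = (LINT t|lebesgue_on {0..1}. \<bar>g t\<bar> powr p) powr (1 / p)"

text \<open>A linear map into \<open>L\<^sub>p([0,1])\<close> is given by a choice of representatives, so it has to be
  linear only up to equality almost everywhere.\<close>

definition embeds_isometrically_in_Lp01 :: "real \<Rightarrow> ('a::real_vector \<Rightarrow> real) \<Rightarrow> bool" where
  "embeds_isometrically_in_Lp01 p N \<longleftrightarrow>
     (\<exists>T. (\<forall>x. T x \<in> Lp01 p) \<and>
          (\<forall>x y. AE t in lebesgue_on {0..1}. T (x + y) t = T x t + T y t) \<and>
          (\<forall>a x. AE t in lebesgue_on {0..1}. T (a *\<^sub>R x) t = a * T x t) \<and>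
          (\<forall>x. Lp01_norm p (T x) = N x))"

definition unit_ball_of_Lp_subspace :: "real \<Rightarrow> ('a::real_vector) set \<Rightarrow> bool" where
  "unit_ball_of_Lp_subspace p L \<longleftrightarrow>
     (\<exists>N. is_norm N \<and> embeds_isometrically_in_Lp01 p N \<and> L = {x. N x \<le> 1})"

definition orthonormal_basis_of :: "'a::euclidean_space set \<Rightarrow> 'a set \<Rightarrow> bool" where
  "orthonormal_basis_of S B \<longleftrightarrow>
     pairwise orthogonal B \<and> (\<forall>b\<in>B. norm b = 1) \<and> span B = S"

text \<open>For a subspace \<open>S\<close>, the \<open>dim S\<close>-dimensional Lebesgue measure on \<open>S\<close> as a measure on the
  ambient space: the image of the product Lebesgue measure under the isometry that an orthonormal
  basis of \<open>S\<close> induces, just as \<^const>\<open>lborel\<close> is obtained from the standard basis.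
  Since Lebesgue measure is invariant under orthogonal maps, the result does not depend
  on the basis that is chosen.\<close>

definition subspace_lborel :: "'a::euclidean_space set \<Rightarrow> 'a measure" where
  "subspace_lborel S =
     (let B = (SOME B. orthonormal_basis_of S B)
      in distr (\<Pi>\<^sub>M b\<in>B. lborel) borel (\<lambda>f. \<Sum>b\<in>B. f b *\<^sub>R b))"

lemma orthonormal_basis_of_exists:
  assumes "subspace S"
  shows "\<exists>B. orthonormal_basis_of S B"
  using orthonormal_basis_subspace [OF assms] unfolding orthonormal_basis_of_def by metis

definition hyperplane :: "'a::euclidean_space \<Rightarrow> 'a set" where
  "hyperplane \<xi> = {x. \<xi> \<bullet> x = 0}"

definition dens_measure :: "('a::euclidean_space \<Rightarrow> real) \<Rightarrow> 'a set \<Rightarrow> real" where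
  "dens_measure f A = (LINT x:A|lborel. f x)"

definition dens_section :: "('a::euclidean_space \<Rightarrow> real) \<Rightarrow> 'a set \<Rightarrow> 'a \<Rightarrow> real" where
  "dens_section f A \<xi> = (LINT x:A \<inter> hyperplane \<xi>|subspace_lborel (hyperplane \<xi>). f x)"

text \<open>\<open>|B\<^sub>2\<^sup>n|\<close> to the power \<open>(n - 1)/n\<close>, divided by \<open>|B\<^sub>2\<^sup>n\<^sup>-\<^sup>1|\<close>; by \<open>content_cball\<close>, the value of
  \<^const>\<open>unit_ball_vol\<close> at a dimension is the Lebesgue measure of the Euclidean unit ball.\<close>

definition ball_const :: "nat \<Rightarrow> real" where
  "ball_const n =
     unit_ball_vol (real n) powr ((real n - 1) / real n) / unit_ball_vol (real n - 1)"

end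

theory Submission
  imports Defs
begin

text \<open>
  By Lewis' argument there are a linear map \<open>B\<close> of determinant \<open>\<plusminus>1\<close> and \<open>\<rho> > 0\<close> such that
  \<open>{x. norm (B x) \<le> \<rho>} \<subseteq> L \<subseteq> {x. norm (B x) \<le> n powr (1/2 - 1/p) * \<rho>}\<close>: writing the norm as
  \<open>N x powr p = \<integral>\<bar>x \<bullet> w\<bar> powr p\<close>, a matrix \<open>A\<close> that minimises \<open>\<integral>(norm (A w)) powr p\<close> under
  \<open>\<bar>det A\<bar> = 1\<close> makes \<open>\<integral>(norm u) powr (p - 2) * u\<^sub>i * u\<^sub>j\<close> a multiple of the identity, where
  \<open>u = A w\<close>, and \<open>B\<close> is the inverse transpose of \<open>A\<close>.

  The second ingredient is an average over hyperplanes. Integrate the mass of the slab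
  \<open>\<bar>x \<bullet> \<xi>\<bar> \<le> \<epsilon>\<close> over all \<open>\<xi>\<close> in the ellipsoid \<open>norm (A \<xi>) \<le> 1\<close>, which has the volume of the unit
  ball. Integrating over \<open>\<xi>\<close> first, every \<open>x \<in> L\<close> contributes at least the volume of a slab of the
  unit ball. Integrating over \<open>x\<close> first, the slab mass is asymptotically at most
  \<open>2 * \<epsilon> / norm \<xi>\<close> times the maximal section, and the integral of \<open>1 / norm \<xi>\<close> over a set of given
  volume is largest for the ball.
\<close>

section \<open>Lebesgue measure in orthonormal coordinates\<close>

text \<open>The averaging ellipsoid is the polar body of \<open>{x. norm (B x) \<le> 1}\<close>:
  with \<open>y = B x\<close> and \<open>\<eta> = A \<xi>\<close> the pairing
  \<open>x \<bullet> \<xi>\<close> becomes \<open>y \<bullet> \<eta>\<close>, so a point of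
  \<open>L\<close> sees a slab of the round ball whose width depends only on a bound for
  \<open>norm (B x)\<close>. This is where the outer radius enters; the inner radius serves to bound
  \<open>\<rho>\<close> by a power of the volume of \<open>L\<close>. Hence the constants:
  \<open>n powr (1/2 - 1/p)\<close> is the ratio of the two radii, \<open>n / (n - 1)\<close> is the
  mean of \<open>1 / norm \<xi>\<close> over the unit ball, and \<open>ball_const\<close> is the
  ratio of the ball volumes in dimensions \<open>n\<close> and \<open>n - 1\<close> after
  \<open>\<rho>\<close> has been bounded by volumes. The delicate point is the passage from slabs to
  sections. What carries it is upper semicontinuity of the slab mass jointly in direction and width,
  a consequence of the compactness of \<open>L\<close>; it yields both a direction with maximal
  section and the limit. For \<open>\<xi>\<close> near 0 the slab is not thin, so convergence is not
  uniform, and the limit is a reverse Fatou argument whose majorant is a multiple of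
  \<open>1 / norm \<xi>\<close>. Its integrability is where dimension at least 2 matters.\<close>

lemma distr_PiM_lborel_reindex:
  assumes "bij_betw \<sigma> B C" "finite B"
  shows "distr (\<Pi>\<^sub>M b\<in>C. lborel) (\<Pi>\<^sub>M b\<in>B. lborel) (\<lambda>f. \<lambda>b\<in>B. f (\<sigma> b)) = (\<Pi>\<^sub>M b\<in>B. (lborel :: real measure))"
proof -
  interpret product_sigma_finite "\<lambda>_. lborel :: real measure" by standard
  have fC: "finite C" using assms bij_betw_finite by blast
  have \<sigma>: "\<sigma> b \<in> C" if "b \<in> B" for b using assms that by (auto simp: bij_betw_def)
  have meas[measurable]: "(\<lambda>f. \<lambda>b\<in>B. f (\<sigma> b)) \<in> (\<Pi>\<^sub>M b\<in>C. (lborel :: real measure)) \<rightarrow>\<^sub>M (\<Pi>\<^sub>M b\<in>B. (lborel :: real measure))"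
    using \<sigma> by (intro measurable_restrict measurable_component_singleton)
  show ?thesis
  proof (rule PiM_eqI)
    fix A :: "'a \<Rightarrow> real set" assume A: "\<And>i. i \<in> B \<Longrightarrow> A i \<in> sets lborel"
    let ?\<tau> = "the_inv_into B \<sigma>"
    have \<tau>: "?\<tau> c \<in> B" "\<sigma> (?\<tau> c) = c" if "c \<in> C" for c
      using assms that by (auto simp: bij_betw_def the_inv_into_into f_the_inv_into_f)
    have \<tau>\<sigma>: "?\<tau> (\<sigma> b) = b" if "b \<in> B" for b
      using assms that by (auto simp: bij_betw_def the_inv_into_f_f)
    have "(\<lambda>f. \<lambda>b\<in>B. f (\<sigma> b)) -` Pi\<^sub>E B A \<inter> space (\<Pi>\<^sub>M b\<in>C. lborel) = (\<Pi>\<^sub>E c\<in>C. A (?\<tau> c))"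
    proof (intro equalityI subsetI)
      fix f assume "f \<in> (\<lambda>f. \<lambda>b\<in>B. f (\<sigma> b)) -` Pi\<^sub>E B A \<inter> space (\<Pi>\<^sub>M b\<in>C. lborel)"
      then have f: "\<And>b. b \<in> B \<Longrightarrow> f (\<sigma> b) \<in> A b" "f \<in> extensional C"
        by (auto simp: space_PiM PiE_iff)
      show "f \<in> (\<Pi>\<^sub>E c\<in>C. A (?\<tau> c))"
        using f(1)[OF \<tau>(1)] \<tau>(2) f(2) by (auto simp: PiE_iff)
    next
      fix f assume f: "f \<in> (\<Pi>\<^sub>E c\<in>C. A (?\<tau> c))"
      then have "f (\<sigma> b) \<in> A b" if "b \<in> B" for b
        using \<sigma>[OF that] \<tau>\<sigma>[OF that] by (metis PiE_mem)
      then show "f \<in> (\<lambda>f. \<lambda>b\<in>B. f (\<sigma> b)) -` Pi\<^sub>E B A \<inter> space (\<Pi>\<^sub>M b\<in>C. lborel)"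
        using f by (auto simp: space_PiM PiE_iff)
    qed
    then have "emeasure (distr (\<Pi>\<^sub>M b\<in>C. lborel) (\<Pi>\<^sub>M b\<in>B. lborel) (\<lambda>f. \<lambda>b\<in>B. f (\<sigma> b))) (Pi\<^sub>E B A)
       = emeasure (\<Pi>\<^sub>M b\<in>C. lborel) (\<Pi>\<^sub>E c\<in>C. A (?\<tau> c))"
      using A assms by (subst emeasure_distr) (auto intro!: sets_PiM_I_finite)
    also have "\<dots> = (\<Prod>c\<in>C. emeasure lborel (A (?\<tau> c)))"
      using A fC \<tau> by (intro emeasure_PiM) auto
    also have "\<dots> = (\<Prod>b\<in>B. emeasure lborel (A (?\<tau> (\<sigma> b))))"
      using prod.reindex_bij_betw [OF assms(1), of "\<lambda>c. emeasure lborel (A (?\<tau> c))"] by simp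
    also have "\<dots> = (\<Prod>b\<in>B. emeasure lborel (A b))"
      by (intro prod.cong) (auto simp: \<tau>\<sigma>)
    finally show "emeasure (distr (\<Pi>\<^sub>M b\<in>C. lborel) (\<Pi>\<^sub>M b\<in>B. lborel) (\<lambda>f. \<lambda>b\<in>B. f (\<sigma> b))) (Pi\<^sub>E B A)
       = (\<Prod>b\<in>B. emeasure lborel (A b))" .
  qed (use assms in auto)
qed

lemma measurable_PiM_sum_scaleR [measurable]:
  "finite B \<Longrightarrow> (\<lambda>f. \<Sum>b\<in>B. f b *\<^sub>R v b) \<in> (\<Pi>\<^sub>M b\<in>B. (lborel :: real measure)) \<rightarrow>\<^sub>M (borel :: 'a::euclidean_space measure)"
  by (intro borel_measurable_sum borel_measurable_scaleR) measurable

lemma nn_integral_PiM_sum_insert: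
  fixes h :: "'a::euclidean_space \<Rightarrow> ennreal"
  assumes "finite B" "a \<notin> B" and [measurable]: "h \<in> borel_measurable borel"
  shows "(\<integral>\<^sup>+y. h (\<Sum>b\<in>insert a B. y b *\<^sub>R v b) \<partial>(\<Pi>\<^sub>M b\<in>insert a B. lborel)) =
    (\<integral>\<^sup>+y. \<integral>\<^sup>+t. h ((\<Sum>b\<in>B. y b *\<^sub>R v b) + t *\<^sub>R v a) \<partial>lborel \<partial>(\<Pi>\<^sub>M b\<in>B. (lborel :: real measure)))"
proof -
  interpret product_sigma_finite "\<lambda>_. lborel :: real measure" by standard
  have *: "(\<Sum>b\<in>insert a B. (y(a := t)) b *\<^sub>R v b) = (\<Sum>b\<in>B. y b *\<^sub>R v b) + t *\<^sub>R v a" for y t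
  proof -
    have "(\<Sum>b\<in>insert a B. (y(a := t)) b *\<^sub>R v b) = t *\<^sub>R v a + (\<Sum>b\<in>B. (y(a := t)) b *\<^sub>R v b)"
      using assms by simp
    also have "(\<Sum>b\<in>B. (y(a := t)) b *\<^sub>R v b) = (\<Sum>b\<in>B. y b *\<^sub>R v b)"
      using assms by (intro sum.cong) auto
    finally show ?thesis by simp
  qed
  show ?thesis
    using assms
    by (subst product_nn_integral_insert)
       (auto simp only: * intro!: measurable_compose [OF measurable_PiM_sum_scaleR assms(3)] finite_insert[THEN iffD2])
qed

text \<open>Linear self-maps are generated under composition by maps with a vanishing coordinate,
  diagonal maps, transpositions and shears, and each type reduces to a symmetry of product Lebesgue
  measure. \<open>P\<close> quantifies over all \<open>h\<close> because a composition uses it for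
  \<open>f\<close> with \<open>h\<close> and for \<open>g\<close> with \<open>h \<circ> f\<close>.
  The determinant condition sits inside \<open>P\<close>, so singular maps satisfy it
  vacuously.\<close>

lemma nn_integral_lborel_linear_image:
  fixes f :: "real^'n \<Rightarrow> real^'n" and h :: "real^'n \<Rightarrow> ennreal"
  assumes "linear f" "det (matrix f) \<noteq> 0" "h \<in> borel_measurable borel"
  shows "(\<integral>\<^sup>+x. h x \<partial>lborel) = ennreal \<bar>det (matrix f)\<bar> * (\<integral>\<^sup>+x. h (f x) \<partial>lborel)"
proof -
  define P where "P f \<longleftrightarrow> (det (matrix f) \<noteq> 0 \<longrightarrow> (\<forall>h\<in>borel_measurable borel.
     (\<integral>\<^sup>+x. h x \<partial>lborel) = ennreal \<bar>det (matrix f)\<bar> * (\<integral>\<^sup>+x. h (f x) \<partial>lborel)))" for f :: "real^'n \<Rightarrow> real^'n"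
  have meas: "f \<in> borel_measurable borel" if "linear f" for f :: "real^'n \<Rightarrow> real^'n"
    using that by (intro borel_measurable_continuous_onI linear_continuous_on linear_conv_bounded_linear[THEN iffD1])
  have "P f"
  proof (rule induct_linear_elementary [OF assms(1)])
    fix f g :: "real^'n \<Rightarrow> real^'n" assume lin: "linear f" "linear g" and "P f" "P g"
    have m: "det (matrix (f \<circ> g)) = det (matrix f) * det (matrix g)"
      using matrix_compose [OF lin(2,1)] by (simp add: det_mul)
    show "P (f \<circ> g)"
      unfolding P_def
    proof (intro impI ballI)
      fix h :: "real^'n \<Rightarrow> ennreal" assume h[measurable]: "h \<in> borel_measurable borel"
      assume nz: "det (matrix (f \<circ> g)) \<noteq> 0"
      have hf: "(\<lambda>x. h (f x)) \<in> borel_measurable borel"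
        using meas[OF lin(1)] by measurable
      have "(\<integral>\<^sup>+x. h x \<partial>lborel) = ennreal \<bar>det (matrix f)\<bar> * (\<integral>\<^sup>+x. h (f x) \<partial>lborel)"
        using \<open>P f\<close> nz m h by (auto simp: P_def)
      also have "(\<integral>\<^sup>+x. h (f x) \<partial>lborel) = ennreal \<bar>det (matrix g)\<bar> * (\<integral>\<^sup>+x. h (f (g x)) \<partial>lborel)"
        using \<open>P g\<close> nz m hf by (auto simp: P_def)
      finally show "(\<integral>\<^sup>+x. h x \<partial>lborel) = ennreal \<bar>det (matrix (f \<circ> g))\<bar> * (\<integral>\<^sup>+x. h ((f \<circ> g) x) \<partial>lborel)"
        by (simp add: m abs_mult ennreal_mult mult_ac)
    qed
  next
    fix f :: "real^'n \<Rightarrow> real^'n" and i assume f: "linear f" "\<And>x. f x $ i = 0"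
    then have "\<not> inj f"
      by (metis (full_types) linear_injective_imp_surjective one_neq_zero surjE vec_component)
    then have "det (matrix f) = 0"
      using det_nz_iff_inj [OF f(1)] by blast
    then show "P f" by (simp add: P_def)
  next
    fix c :: "'n \<Rightarrow> real"
    let ?f = "\<lambda>x::real^'n. \<chi> i. c i * x $ i"
    \<comment> \<open>The scaling rule for \<open>lborel\<close> indexes its factors by basis
      vectors, so the coefficients \<open>c\<close> have to be moved from coordinates to basis
      vectors.\<close>
    define d where "d j = c (THE i. j = axis i (1::real))" for j
    have d: "d (axis i 1) = c i" for i
      by (simp add: d_def axis_eq_axis)
    have det: "det (matrix ?f) = prod c UNIV"
      by (simp add: axis_def matrix_def det_diagonal)
    have inj: "inj (\<lambda>i::'n. axis i (1::real))" by (auto simp: inj_def axis_eq_axis)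
    have B: "Basis = range (\<lambda>i::'n. axis i (1::real))" by (auto simp: Basis_vec_def)
    have f: "?f = (\<lambda>x. 0 + (\<Sum>j\<in>Basis. (d j * (x \<bullet> j)) *\<^sub>R j))"
      unfolding B sum.reindex[OF inj]
      by (simp add: d inner_axis fun_eq_iff, simp add: vec_eq_iff axis_def if_distrib cong: if_cong)
    have d_prod: "(\<Prod>j\<in>Basis. \<bar>d j\<bar>) = \<bar>prod c UNIV\<bar>"
      by (simp add: B prod.reindex[OF inj] d abs_prod)
    have "d j \<noteq> 0" if "prod c UNIV \<noteq> 0" "j \<in> Basis" for j
      using that by (auto simp: B d)
    then have "lborel = density (distr lborel borel ?f) (\<lambda>_. \<bar>prod c UNIV\<bar>)" if "prod c UNIV \<noteq> 0"
      unfolding f d_prod[symmetric] using that by (blast intro: lborel_affine_euclidean[of d 0])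
    then show "P ?f"
      unfolding P_def det
    proof (intro impI ballI)
      fix h :: "real^'n \<Rightarrow> ennreal" assume [measurable]: "h \<in> borel_measurable borel"
      assume *: "prod c UNIV \<noteq> 0 \<Longrightarrow> lborel = density (distr lborel borel ?f) (\<lambda>_. \<bar>prod c UNIV\<bar>)"
        "prod c UNIV \<noteq> 0"
      have [measurable]: "?f \<in> borel_measurable borel"
        by (intro meas linearI) (auto simp: vec_eq_iff algebra_simps)
      show "(\<integral>\<^sup>+x. h x \<partial>lborel) = ennreal \<bar>prod c UNIV\<bar> * (\<integral>\<^sup>+x. h (?f x) \<partial>lborel)"
      proof -
        have "(\<integral>\<^sup>+x. h x \<partial>lborel) = (\<integral>\<^sup>+x. h x \<partial>density (distr lborel borel ?f) (\<lambda>_. \<bar>prod c UNIV\<bar>))"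
          using *(1)[OF *(2)] by (rule arg_cong)
        then show ?thesis by (simp add: nn_integral_density nn_integral_distr nn_integral_cmult del: abs_prod)
      qed
    qed
  next
    fix m n :: 'n assume "m \<noteq> n"
    let ?s = "Transposition.transpose m n"
    let ?f = "\<lambda>x::real^'n. \<chi> i. x $ ?s i"
    \<comment> \<open>The transposition of coordinates becomes a permutation of the index set
      \<open>Basis\<close> of the product measure.\<close>
    define \<sigma> where "\<sigma> j = axis (?s (THE i. j = axis i (1::real))) (1::real)" for j
    have \<sigma>: "\<sigma> (axis i 1) = axis (?s i) 1" for i
      by (simp add: \<sigma>_def axis_eq_axis)
    have inj: "inj (\<lambda>i::'n. axis i (1::real))" by (auto simp: inj_def axis_eq_axis)
    have B: "Basis = range (\<lambda>i::'n. axis i (1::real))" by (auto simp: Basis_vec_def)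
    have bij: "bij_betw \<sigma> Basis (Basis::(real^'n) set)"
      by (rule bij_betw_byWitness[of _ \<sigma>]) (auto simp: B \<sigma>)
    have lin: "linear ?f" by (intro linearI) (auto simp: vec_eq_iff)
    note [measurable] = meas[OF lin]
    have "?f \<circ> ?f = id" by (auto simp: vec_eq_iff)
    then have "det (matrix ?f) * det (matrix ?f) = 1"
      using matrix_compose [OF lin lin] by (metis det_I det_mul matrix_id_mat_1)
    then have det: "\<bar>det (matrix ?f)\<bar> = 1"
      by (simp add: abs_square_eq_1 [symmetric] power2_eq_square)
    have f: "?f (\<Sum>j\<in>Basis. y j *\<^sub>R j) = (\<Sum>j\<in>Basis. (\<lambda>b\<in>Basis. y (\<sigma> b)) j *\<^sub>R j)" for y
      unfolding B sum.reindex[OF inj] o_def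
      by (simp add: \<sigma>, simp add: vec_eq_iff axis_def if_distrib cong: if_cong)
    show "P ?f"
      unfolding P_def det
    proof (intro impI ballI)
      fix h :: "real^'n \<Rightarrow> ennreal" assume [measurable]: "h \<in> borel_measurable borel"
      let ?P = "\<Pi>\<^sub>M b\<in>(Basis::(real^'n) set). (lborel :: real measure)"
      let ?S = "\<lambda>y. \<lambda>b\<in>(Basis::(real^'n) set). y (\<sigma> b) :: real"
      have [measurable]: "?S \<in> ?P \<rightarrow>\<^sub>M ?P"
        using bij by (intro measurable_restrict measurable_component_singleton) (auto simp: bij_betw_def)
      have "(\<integral>\<^sup>+x. h x \<partial>lborel) = (\<integral>\<^sup>+y. h (\<Sum>j\<in>Basis. y j *\<^sub>R j) \<partial>?P)"
        by (subst lborel_eq) (simp add: nn_integral_distr)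
      also have "\<dots> = (\<integral>\<^sup>+y. h (\<Sum>j\<in>Basis. y j *\<^sub>R j) \<partial>distr ?P ?P ?S)"
        by (subst distr_PiM_lborel_reindex[OF bij]) auto
      also have "\<dots> = (\<integral>\<^sup>+y. h (?f (\<Sum>j\<in>Basis. y j *\<^sub>R j)) \<partial>?P)"
        unfolding f by (rule nn_integral_distr) measurable
      also have "\<dots> = (\<integral>\<^sup>+x. h (?f x) \<partial>lborel)"
        by (subst lborel_eq, subst nn_integral_distr) auto
      finally show "(\<integral>\<^sup>+x. h x \<partial>lborel) = ennreal 1 * (\<integral>\<^sup>+x. h (?f x) \<partial>lborel)" by simp
    qed
  next
    fix m n :: 'n assume mn: "m \<noteq> n"
    let ?f = "\<lambda>x::real^'n. \<chi> i. if i = m then x $ m + x $ n else x $ i"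
    let ?a = "axis m 1 :: real^'n"
    let ?B = "Basis - {?a}"
    have f: "?f x = x + (x $ n) *\<^sub>R ?a" for x
      by (auto simp: vec_eq_iff axis_def)
    have "matrix ?f = (\<chi> k. if k = m then row m (mat 1) + 1 *s row n (mat 1) else row k (mat 1))"
      by (auto simp: matrix_def vec_eq_iff row_def mat_def axis_def)
    then have det: "det (matrix ?f) = 1"
      using det_row_operation[OF mn, of "mat 1 :: real^'n^'n" 1] by simp
    have a: "?a \<in> Basis" by simp
    show "P ?f"
      unfolding P_def det
    proof (intro impI ballI)
      fix h :: "real^'n \<Rightarrow> ennreal" assume h[measurable]: "h \<in> borel_measurable borel"
      have [measurable]: "(\<lambda>x. h (?f x)) \<in> borel_measurable borel"
        by (intro measurable_compose[OF _ h] meas linearI) (auto simp: vec_eq_iff algebra_simps)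
      have *: "(\<integral>\<^sup>+x. g x \<partial>lborel) = (\<integral>\<^sup>+y. \<integral>\<^sup>+t. g ((\<Sum>b\<in>?B. y b *\<^sub>R b) + t *\<^sub>R ?a) \<partial>lborel \<partial>(\<Pi>\<^sub>M b\<in>?B. lborel))"
        if [measurable]: "g \<in> borel_measurable borel" for g :: "real^'n \<Rightarrow> ennreal"
        by (subst lborel_eq, subst nn_integral_distr)
           (use nn_integral_PiM_sum_insert[of ?B ?a g "\<lambda>b. b"] in \<open>auto simp: insert_absorb[OF a]\<close>)
      \<comment> \<open>With the coordinate along \<open>?a\<close> integrated first, the shear only
        translates it by the \<open>n\<close>-th coordinate, which is constant in \<open>t\<close>
        because \<open>m\<close> and \<open>n\<close> differ.\<close>
      have "(\<integral>\<^sup>+t. h (?f ((\<Sum>b\<in>?B. y b *\<^sub>R b) + t *\<^sub>R ?a)) \<partial>lborel) =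
            (\<integral>\<^sup>+t. h ((\<Sum>b\<in>?B. y b *\<^sub>R b) + t *\<^sub>R ?a) \<partial>lborel)" for y
      proof -
        let ?s = "\<Sum>b\<in>?B. y b *\<^sub>R b"
        have "?f (?s + t *\<^sub>R ?a) = ?s + (?s $ n + 1 * t) *\<^sub>R ?a" for t
          using mn by (auto simp: f axis_def algebra_simps)
        then show ?thesis
          by (simp only:) (subst (2) nn_integral_real_affine[of _ 1 "?s $ n"], auto)
      qed
      then show "(\<integral>\<^sup>+x. h x \<partial>lborel) = ennreal \<bar>1\<bar> * (\<integral>\<^sup>+x. h (?f x) \<partial>lborel)"
        by (simp add: *)
    qed
  qed
  then show ?thesis using assms by (auto simp: P_def)
qed

lemma distr_lborel_matrix:
  fixes A :: "real^'n^'n"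
  assumes "\<bar>det A\<bar> = 1"
  shows "distr lborel borel ((*v) A) = lborel"
proof (rule measure_eqI)
  have [measurable]: "(*v) A \<in> borel_measurable borel"
    by (intro borel_measurable_continuous_onI linear_continuous_on) simp
  fix X assume "X \<in> sets (distr lborel borel ((*v) A))"
  then have [measurable]: "X \<in> sets borel" by simp
  have "emeasure lborel X = (\<integral>\<^sup>+x. indicator X x \<partial>lborel)" by simp
  also have "\<dots> = (\<integral>\<^sup>+x. indicator X (A *v x) \<partial>lborel)"
    using assms by (subst nn_integral_lborel_linear_image[of "(*v) A"]) auto
  also have "\<dots> = (\<integral>\<^sup>+x. indicator X x \<partial>distr lborel borel ((*v) A))"
    by (subst nn_integral_distr) auto
  finally show "emeasure (distr lborel borel ((*v) A)) X = emeasure lborel X" by simp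
qed simp

section \<open>Coordinates in an arbitrary orthonormal basis\<close>

lemma orthonormal_basis_ofD:
  assumes "orthonormal_basis_of S B"
  shows "pairwise orthogonal B" "\<And>b. b \<in> B \<Longrightarrow> norm b = 1" "span B = S"
    and "independent B" "finite B" "card B = dim S"
proof -
  show *: "pairwise orthogonal B" "\<And>b. b \<in> B \<Longrightarrow> norm b = 1" "span B = S"
    using assms by (auto simp: orthonormal_basis_of_def)
  then have "0 \<notin> B" by force
  then show i: "independent B" using * pairwise_orthogonal_independent by blast
  then show "finite B" using independent_imp_finite by blast
  show "card B = dim S" using dim_eq_card_independent [OF i] *(3) dim_span by metis
qed

text \<open>The linear map that carries the standard basis to \<open>B\<close> is orthogonal and
  hence preserves Lebesgue measure. Read in coordinates it merely renames the index set of the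
  product.\<close>

lemma lborel_eq_orthonormal_basis:
  fixes B :: "(real^'n) set"
  assumes "orthonormal_basis_of UNIV B"
  shows "lborel = distr (\<Pi>\<^sub>M b\<in>B. lborel) borel (\<lambda>f. \<Sum>b\<in>B. f b *\<^sub>R b)"
proof -
  note B = orthonormal_basis_ofD [OF assms]
  have "card B = card (Basis :: (real^'n) set)" using B(6) by simp
  then obtain \<sigma> where \<sigma>: "bij_betw \<sigma> B (Basis :: (real^'n) set)"
    using B(5) finite_same_card_bij by (metis finite_Basis)
  define \<tau> where "\<tau> = the_inv_into B \<sigma>"
  have \<tau>: "\<tau> c \<in> B" "\<sigma> (\<tau> c) = c" if "c \<in> Basis" for c
    using \<sigma> that by (auto simp: \<tau>_def bij_betw_def the_inv_into_into f_the_inv_into_f)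
  have \<tau>\<sigma>: "\<tau> (\<sigma> b) = b" "\<sigma> b \<in> Basis" if "b \<in> B" for b
    using \<sigma> that by (auto simp: \<tau>_def bij_betw_def the_inv_into_f_f)
  define T :: "real^'n \<Rightarrow> real^'n" where "T x = (\<Sum>c\<in>Basis. (x \<bullet> c) *\<^sub>R \<tau> c)" for x
  have linT: "linear T"
    unfolding T_def by (auto intro!: linearI simp: inner_add_left scaleR_add_left sum.distrib scaleR_sum_right)
  have T\<tau>: "\<tau> c \<bullet> \<tau> d = (if c = d then 1 else 0)" if "c \<in> Basis" "d \<in> Basis" for c d
  proof (cases "c = d")
    case True
    then show ?thesis using B(2)[OF \<tau>(1)[OF that(2)]] by (simp add: dot_square_norm)
  next
    case False
    then have "\<tau> c \<noteq> \<tau> d" using \<tau>(2) that by metis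
    then show ?thesis using B(1) \<tau>(1) that False by (auto simp: pairwise_def orthogonal_def)
  qed
  have "T x \<bullet> T y = x \<bullet> y" for x y
  proof -
    have "T x \<bullet> T y = (\<Sum>c\<in>Basis. \<Sum>d\<in>Basis. (x \<bullet> c) * (y \<bullet> d) * (\<tau> c \<bullet> \<tau> d))"
      by (simp add: T_def inner_sum_left inner_sum_right sum_distrib_left mult_ac) (subst sum.swap, simp add: inner_commute)
    also have "\<dots> = (\<Sum>c\<in>Basis. \<Sum>d\<in>Basis. if c = d then (x \<bullet> c) * (y \<bullet> d) else 0)"
      by (intro sum.cong refl) (auto simp: T\<tau>)
    also have "\<dots> = x \<bullet> y" by (simp add: euclidean_inner [of x y])
    finally show ?thesis .
  qed
  then have "orthogonal_transformation T" using linT by (simp add: orthogonal_transformation_def)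
  then have "\<bar>det (matrix T)\<bar> = 1" by simp
  then have "distr lborel borel ((*v) (matrix T)) = lborel" by (rule distr_lborel_matrix)
  then have "distr lborel borel T = lborel" using linT by (simp add: matrix_works)
  moreover have [measurable]: "T \<in> borel_measurable borel"
    using linT by (intro borel_measurable_continuous_onI linear_continuous_on linear_conv_bounded_linear[THEN iffD1])
  ultimately have "lborel = distr (\<Pi>\<^sub>M b\<in>Basis. lborel) borel (T \<circ> (\<lambda>f. \<Sum>b\<in>Basis. f b *\<^sub>R b))"
    by (subst (asm) (1) lborel_eq) (simp add: distr_distr)
  also have "T \<circ> (\<lambda>f. \<Sum>b\<in>Basis. f b *\<^sub>R b) = (\<lambda>f. \<Sum>b\<in>B. f b *\<^sub>R b) \<circ> (\<lambda>f. \<lambda>b\<in>B. f (\<sigma> b))"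
  proof
    fix f :: "real^'n \<Rightarrow> real"
    have "T (\<Sum>b\<in>Basis. f b *\<^sub>R b) = (\<Sum>b\<in>Basis. f b *\<^sub>R \<tau> b)"
      unfolding T_def by (intro sum.cong refl) (simp add: inner_sum_left_Basis)
    also have "\<dots> = (\<Sum>b\<in>B. f (\<sigma> b) *\<^sub>R \<tau> (\<sigma> b))"
      using sum.reindex_bij_betw [OF \<sigma>, of "\<lambda>b. f b *\<^sub>R \<tau> b"] by simp
    finally show "(T \<circ> (\<lambda>f. \<Sum>b\<in>Basis. f b *\<^sub>R b)) f = ((\<lambda>f. \<Sum>b\<in>B. f b *\<^sub>R b) \<circ> (\<lambda>f. \<lambda>b\<in>B. f (\<sigma> b))) f"
      by (simp add: \<tau>\<sigma>)
  qed
  also have "distr (\<Pi>\<^sub>M b\<in>Basis. lborel) borel \<dots> =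
      distr (distr (\<Pi>\<^sub>M b\<in>Basis. lborel) (\<Pi>\<^sub>M b\<in>B. lborel) (\<lambda>f. \<lambda>b\<in>B. f (\<sigma> b))) borel (\<lambda>f. \<Sum>b\<in>B. f b *\<^sub>R b)"
    using \<tau>\<sigma> B(5) by (intro distr_distr [symmetric] measurable_restrict measurable_component_singleton measurable_PiM_sum_scaleR) auto
  also have "distr (\<Pi>\<^sub>M b\<in>Basis. lborel) (\<Pi>\<^sub>M b\<in>B. lborel) (\<lambda>f. \<lambda>b\<in>B. f (\<sigma> b)) = (\<Pi>\<^sub>M b\<in>B. (lborel::real measure))"
    by (rule distr_PiM_lborel_reindex [OF \<sigma> B(5)])
  finally show ?thesis .
qed

lemma orthonormal_basis_of_insert_hyperplane:
  fixes \<xi> :: "'a::euclidean_space"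
  assumes "orthonormal_basis_of (hyperplane \<xi>) B" "norm \<xi> = 1"
  shows "orthonormal_basis_of UNIV (insert \<xi> B)" "\<xi> \<notin> B" "card B = DIM('a) - 1"
proof -
  note B = orthonormal_basis_ofD [OF assms(1)]
  have xi: "\<xi> \<bullet> \<xi> = 1" using assms(2) by (simp add: dot_square_norm)
  have orth: "\<xi> \<bullet> b = 0" if "b \<in> B" for b
    using B(3) that span_base[of b B] by (auto simp: hyperplane_def)
  show "\<xi> \<notin> B" using orth xi by force
  have "x \<in> span (insert \<xi> B)" for x
  proof -
    have "x - (\<xi> \<bullet> x) *\<^sub>R \<xi> \<in> span B"
      using xi by (simp add: B(3) hyperplane_def inner_diff_right)
    then show ?thesis by (auto simp: span_insert)
  qed
  then have "span (insert \<xi> B) = UNIV" by blast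
  then show o: "orthonormal_basis_of UNIV (insert \<xi> B)"
    using B orth assms(2) unfolding orthonormal_basis_of_def
    by (auto simp: pairwise_insert orthogonal_def inner_commute)
  show "card B = DIM('a) - 1"
    using orthonormal_basis_ofD(6)[OF o] \<open>\<xi> \<notin> B\<close> B(5) by simp
qed

text \<open>Tonelli along the lines orthogonal to the hyperplane. The basis \<open>B\<close> stays
  arbitrary so that it can later be the one that \<open>subspace_lborel\<close> selects.\<close>

lemma nn_integral_lborel_hyperplane:
  fixes \<xi> :: "real^'n"
  assumes B: "orthonormal_basis_of (hyperplane \<xi>) B" and "norm \<xi> = 1"
    and [measurable]: "h \<in> borel_measurable borel"
  shows "(\<integral>\<^sup>+x. h x \<partial>lborel) =
    (\<integral>\<^sup>+y. \<integral>\<^sup>+t. h ((\<Sum>b\<in>B. y b *\<^sub>R b) + t *\<^sub>R \<xi>) \<partial>lborel \<partial>(\<Pi>\<^sub>M b\<in>B. lborel))"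
proof -
  note I = orthonormal_basis_of_insert_hyperplane [OF assms(1,2)]
  have fin: "finite B" using orthonormal_basis_ofD[OF B] by blast
  have "(\<integral>\<^sup>+x. h x \<partial>lborel) = (\<integral>\<^sup>+y. h (\<Sum>b\<in>insert \<xi> B. y b *\<^sub>R b) \<partial>(\<Pi>\<^sub>M b\<in>insert \<xi> B. lborel))"
    using fin by (subst lborel_eq_orthonormal_basis [OF I(1)], subst nn_integral_distr) (auto intro: measurable_PiM_sum_scaleR)
  then show ?thesis using nn_integral_PiM_sum_insert[OF fin I(2) assms(3)] by simp
qed

section \<open>Hyperplane sections as limits of slabs\<close>

text \<open>Twice the mean density of \<open>g\<close> over the slab \<open>\<bar>x \<bullet> \<xi>\<bar> \<le> s\<close>, for a unit vector \<open>\<xi>\<close>. The slab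
  is rescaled to half-width 1, so that the value at \<open>s = 0\<close> is twice the integral over the central
  hyperplane section and the dependence on \<open>(\<xi>, s)\<close> is upper semicontinuous.\<close>

definition slab_mean :: "('a::euclidean_space \<Rightarrow> ennreal) \<Rightarrow> 'a \<Rightarrow> real \<Rightarrow> ennreal" where
  "slab_mean g \<xi> s = (\<integral>\<^sup>+z. g (z + ((s - 1) * (z \<bullet> \<xi>)) *\<^sub>R \<xi>) * indicator {-1..1} (z \<bullet> \<xi>) \<partial>lborel)"

lemma slab_mean_integrand_measurable:
  fixes \<xi> :: "'a::euclidean_space"
  assumes "g \<in> borel_measurable borel"
  shows "(\<lambda>z. g (z + (r * (z \<bullet> \<xi>)) *\<^sub>R \<xi>) * (indicator {-1..1} (z \<bullet> \<xi>) :: ennreal)) \<in> borel_measurable borel"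
proof (rule borel_measurable_times_ennreal)
  show "(\<lambda>z. g (z + (r * (z \<bullet> \<xi>)) *\<^sub>R \<xi>)) \<in> borel_measurable borel"
    by (rule measurable_compose[OF _ assms]) (intro borel_measurable_continuous_onI continuous_intros)
  show "(\<lambda>z. indicator {-1..1} (z \<bullet> \<xi>) :: ennreal) \<in> borel_measurable borel"
    by (rule measurable_compose[of _ _ borel]) (auto intro!: borel_measurable_continuous_onI continuous_intros)
qed

lemma subspace_hyperplane_perp: "subspace (hyperplane \<xi>)"
  unfolding hyperplane_def by (rule subspace_hyperplane)

text \<open>The map inside \<open>slab_mean\<close> fixes the component of \<open>z\<close> in the
  hyperplane and multiplies the component along \<open>\<xi>\<close> by \<open>s\<close>.\<close>

lemma slab_mean_hyperplane:
  fixes \<xi> :: "real^'n"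
  assumes B: "orthonormal_basis_of (hyperplane \<xi>) B" and "norm \<xi> = 1"
    and [measurable]: "g \<in> borel_measurable borel"
  shows "slab_mean g \<xi> s = (\<integral>\<^sup>+y. \<integral>\<^sup>+t. g ((\<Sum>b\<in>B. y b *\<^sub>R b) + (s * t) *\<^sub>R \<xi>) * indicator {-1..1} t
    \<partial>lborel \<partial>(\<Pi>\<^sub>M b\<in>B. lborel))"
proof -
  have xi: "\<xi> \<bullet> \<xi> = 1" using assms(2) by (simp add: dot_square_norm)
  have "b \<bullet> \<xi> = 0" if "b \<in> B" for b
    using orthonormal_basis_ofD(3)[OF B] that span_base[of b B] by (auto simp: hyperplane_def inner_commute)
  then have o: "(\<Sum>b\<in>B. y b *\<^sub>R b) \<bullet> \<xi> = 0" for y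
    by (simp add: inner_sum_left)
  show ?thesis
    unfolding slab_mean_def
    by (subst nn_integral_lborel_hyperplane [OF assms(1,2)])
       (simp_all add: inner_add_left o xi algebra_simps flip: scaleR_add_left)
qed

text \<open>At \<open>s = 0\<close> the normal coordinate survives only in the indicator of
  \<open>{-1..1}\<close>, whose length is the factor 2.\<close>

lemma slab_mean_zero:
  fixes \<xi> :: "real^'n"
  assumes "norm \<xi> = 1" and [measurable]: "g \<in> borel_measurable borel"
  shows "slab_mean g \<xi> 0 = 2 * (\<integral>\<^sup>+x. g x \<partial>subspace_lborel (hyperplane \<xi>))"
proof -
  \<comment> \<open>This is literally the choice made in \<open>subspace_lborel\<close>, so
    unfolding that definition identifies the two measures.\<close>
  define B where "B = (SOME B. orthonormal_basis_of (hyperplane \<xi>) B)"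
  have B: "orthonormal_basis_of (hyperplane \<xi>) B"
    unfolding B_def by (rule someI_ex [OF orthonormal_basis_of_exists [OF subspace_hyperplane_perp]])
  then have [simp]: "finite B" using orthonormal_basis_ofD by blast
  show ?thesis
    by (subst slab_mean_hyperplane [OF B assms])
       (simp add: subspace_lborel_def nn_integral_distr nn_integral_cmult nn_integral_multc mult.commute flip: B_def)
qed

lemma slab_mean_pos:
  fixes \<xi> :: "real^'n"
  assumes "norm \<xi> = 1" "s > 0" and [measurable]: "g \<in> borel_measurable borel"
  shows "ennreal s * slab_mean g \<xi> s = (\<integral>\<^sup>+x. g x * indicator {-s..s} (x \<bullet> \<xi>) \<partial>lborel)"
proof -
  obtain B where B: "orthonormal_basis_of (hyperplane \<xi>) B"
    using orthonormal_basis_of_exists [OF subspace_hyperplane_perp] by blast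
  then have [simp]: "finite B" using orthonormal_basis_ofD by blast
  have xi: "\<xi> \<bullet> \<xi> = 1" using assms(1) by (simp add: dot_square_norm)
  have "b \<bullet> \<xi> = 0" if "b \<in> B" for b
    using orthonormal_basis_ofD(3)[OF B] that span_base[of b B] by (auto simp: hyperplane_def inner_commute)
  then have o: "(\<Sum>b\<in>B. y b *\<^sub>R b) \<bullet> \<xi> = 0" for y
    by (simp add: inner_sum_left)
  have "indicator {-s..s} (s * t) = (indicator {-1..1} t :: ennreal)" for t
    using assms(2) mult_le_cancel_left_pos[of s t 1] mult_le_cancel_left_pos[of s "-1" t]
    by (auto simp: indicator_def)
  then have *: "(\<integral>\<^sup>+t. g (v + t *\<^sub>R \<xi>) * indicator {-s..s} t \<partial>lborel) =
      ennreal s * (\<integral>\<^sup>+t. g (v + (s * t) *\<^sub>R \<xi>) * indicator {-1..1} t \<partial>lborel)" for v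
    using assms(2) by (subst nn_integral_real_affine[of _ s 0]) auto
  show ?thesis
    by (subst nn_integral_lborel_hyperplane [OF B assms(1)], measurable)
       (simp add: slab_mean_hyperplane [OF B assms(1,3)] inner_add_left o xi * nn_integral_cmult)
qed

text \<open>Indicators of closed sets are upper semicontinuous: on \<open>A\<close> the indicator
  already has its largest value, and a sequence whose limit lies off \<open>A\<close> eventually
  avoids \<open>A\<close>.\<close>

lemma limsup_mult_indicator_le:
  fixes F :: "'a::topological_space \<Rightarrow> ennreal"
  assumes "closed A" "x \<longlonglongrightarrow> l" "(\<lambda>k. F (x k)) \<longlonglongrightarrow> F l"
  shows "limsup (\<lambda>k. F (x k) * indicator A (x k)) \<le> F l * indicator A l"
proof (cases "l \<in> A")
  case True
  have "limsup (\<lambda>k. F (x k) * indicator A (x k)) \<le> limsup (\<lambda>k. F (x k))"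
    by (intro Limsup_mono always_eventually allI) (auto simp: indicator_def)
  also have "\<dots> = F l" using assms(3) by (intro lim_imp_Limsup) auto
  finally show ?thesis using True by simp
next
  case False
  then have "\<forall>\<^sub>F k in sequentially. x k \<in> - A"
    using assms by (intro topological_tendstoD[OF assms(2)]) auto
  then have "limsup (\<lambda>k. F (x k) * indicator A (x k)) = limsup (\<lambda>k. 0)"
    by (intro Limsup_eq) (auto elim!: eventually_mono)
  then show ?thesis by (simp add: Limsup_const)
qed

text \<open>A majorant that depends neither on the direction nor on the width. The point
  \<open>x\<close> at which \<open>f\<close> is evaluated and \<open>z\<close> have the same
  component in the hyperplane, of norm at most
  \<open>norm x + \<bar>x \<bullet> \<xi>\<bar> \<le> 2 * R\<close>; the normal component of
  \<open>z\<close> adds at most 1.\<close>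

lemma slab_mean_integrand_bound:
  fixes \<xi> :: "'a::euclidean_space"
  assumes "norm \<xi> = 1" "L \<subseteq> cball 0 R" "\<And>x. x \<in> L \<Longrightarrow> f x \<le> C" "0 \<le> C"
  shows "ennreal (f (z + (r * (z \<bullet> \<xi>)) *\<^sub>R \<xi>)) * indicator L (z + (r * (z \<bullet> \<xi>)) *\<^sub>R \<xi>) * indicator {-1..1} (z \<bullet> \<xi>)
     \<le> ennreal C * indicator (cball 0 (2 * R + 1)) z"
proof (cases "z + (r * (z \<bullet> \<xi>)) *\<^sub>R \<xi> \<in> L \<and> z \<bullet> \<xi> \<in> {-1..1}")
  case True
  define x where "x = z + (r * (z \<bullet> \<xi>)) *\<^sub>R \<xi>"
  have x: "x \<in> L" "norm x \<le> R" using True assms(2) by (auto simp: x_def)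
  have xi: "\<xi> \<bullet> \<xi> = 1" using assms(1) by (simp add: dot_square_norm)
  have "norm z = norm (x - (x \<bullet> \<xi>) *\<^sub>R \<xi> + (z \<bullet> \<xi>) *\<^sub>R \<xi>)"
    by (simp add: x_def inner_add_left xi algebra_simps)
  then have "norm z \<le> norm x + norm ((x \<bullet> \<xi>) *\<^sub>R \<xi>) + norm ((z \<bullet> \<xi>) *\<^sub>R \<xi>)"
    using norm_triangle_ineq[of "x - (x \<bullet> \<xi>) *\<^sub>R \<xi>" "(z \<bullet> \<xi>) *\<^sub>R \<xi>"]
      norm_triangle_ineq4[of x "(x \<bullet> \<xi>) *\<^sub>R \<xi>"] by linarith
  then have "norm z \<le> norm x + \<bar>x \<bullet> \<xi>\<bar> + \<bar>z \<bullet> \<xi>\<bar>"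
    using assms(1) by simp
  moreover have "\<bar>x \<bullet> \<xi>\<bar> \<le> norm x" using Cauchy_Schwarz_ineq2[of x \<xi>] assms(1) by simp
  ultimately have "norm z \<le> 2 * R + 1" using x(2) True by auto
  then show ?thesis using True x assms(3)[OF x(1)] by (auto simp: x_def intro!: ennreal_leI)
qed (auto simp: indicator_def)

lemma compact_continuous_bounds:
  fixes f :: "'a::euclidean_space \<Rightarrow> real"
  assumes "compact L" "continuous_on UNIV f"
  obtains R C where "L \<subseteq> cball 0 R" "\<And>x. x \<in> L \<Longrightarrow> f x \<le> C" "0 \<le> C"
proof -
  obtain R where "\<forall>x\<in>L. norm x \<le> R"
    using compact_imp_bounded[OF assms(1)] by (auto simp: bounded_iff)
  then have R: "L \<subseteq> cball 0 R" by auto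
  have "bounded (f ` L)"
    using assms by (intro compact_imp_bounded compact_continuous_image) (auto intro: continuous_on_subset)
  then obtain C where C: "\<forall>x\<in>L. norm (f x) \<le> C" by (auto simp: bounded_iff)
  have "f x \<le> max C 0" if "x \<in> L" for x using C that by force
  then show thesis using that[OF R, of "max C 0"] by simp
qed

text \<open>Reverse Fatou with the uniform majorant. Pointwise the argument gives only an upper
  bound, because the indicators may jump up at a limit point on the boundary of \<open>L\<close> or
  of \<open>{-1..1}\<close>.\<close>

lemma slab_mean_limsup:
  fixes L :: "'a::euclidean_space set"
  assumes L: "compact L" and f: "continuous_on UNIV f" "\<And>x. f x \<ge> 0"
    and "\<And>k. norm (\<xi> k) = 1" "\<xi> \<longlonglongrightarrow> \<eta>" "s \<longlonglongrightarrow> t"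
  shows "limsup (\<lambda>k. slab_mean (\<lambda>x. ennreal (f x) * indicator L x) (\<xi> k) (s k))
       \<le> slab_mean (\<lambda>x. ennreal (f x) * indicator L x) \<eta> t"
proof -
  obtain R C where R: "L \<subseteq> cball 0 R" and C: "\<And>x. x \<in> L \<Longrightarrow> f x \<le> C" "0 \<le> C"
    using compact_continuous_bounds[OF L f(1)] by metis
  have [measurable]: "f \<in> borel_measurable borel" using f(1) by (rule borel_measurable_continuous_onI)
  have [measurable]: "L \<in> sets borel" using L by (simp add: borel_compact)
  let ?g = "\<lambda>x. ennreal (f x) * indicator L x"
  let ?x = "\<lambda>\<xi> s z. z + ((s - 1) * (z \<bullet> \<xi>)) *\<^sub>R \<xi>"
  have "limsup (\<lambda>k. slab_mean ?g (\<xi> k) (s k)) \<le>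
    (\<integral>\<^sup>+z. limsup (\<lambda>k. ?g (?x (\<xi> k) (s k) z) * indicator {-1..1} (z \<bullet> \<xi> k)) \<partial>lborel)"
    unfolding slab_mean_def
  proof (rule nn_integral_limsup)
    show "AE z in lborel. ?g (?x (\<xi> k) (s k) z) * indicator {-1..1} (z \<bullet> \<xi> k)
        \<le> ennreal C * indicator (cball 0 (2 * R + 1)) z" for k
      using slab_mean_integrand_bound [where f = f, OF assms(4) R C] by simp
    show "(\<integral>\<^sup>+z. ennreal C * indicator (cball 0 (2 * R + 1) :: 'a set) z \<partial>lborel) < \<infinity>"
      using emeasure_lborel_cball_finite[of "0::'a" "2 * R + 1"]
      by (subst nn_integral_cmult_indicator) (auto simp: ennreal_mult_less_top)
    have g: "?g \<in> borel_measurable borel" by simp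
    show "(\<lambda>z. ?g (?x (\<xi> k) (s k) z) * indicator {-1..1} (z \<bullet> \<xi> k)) \<in> borel_measurable lborel" for k
      using slab_mean_integrand_measurable[OF g, of "s k - 1" "\<xi> k"] by simp
  qed (auto intro!: borel_measurable_times_ennreal borel_measurable_indicator)
  also have "\<dots> \<le> slab_mean ?g \<eta> t"
    unfolding slab_mean_def
  proof (intro nn_integral_mono)
    fix z :: 'a
    \<comment> \<open>Pairing the evaluation point with the normal coordinate turns the two
      indicators into that of the single closed set \<open>L \<times> {-1..1}\<close>.\<close>
    define F where "F = (\<lambda>(x, r::real). ennreal (f x))"
    define p where "p k = (?x (\<xi> k) (s k) z, z \<bullet> \<xi> k)" for k
    define l where "l = (?x \<eta> t z, z \<bullet> \<eta>)"
    have p: "p \<longlonglongrightarrow> l" unfolding p_def l_def by (intro tendsto_intros assms(5,6))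
    have "(\<lambda>k. f (fst (p k))) \<longlonglongrightarrow> f (fst l)"
      using f(1) tendsto_fst[OF p] by (intro isCont_tendsto_compose[of _ f]) (auto simp: continuous_on_eq_continuous_at)
    then have "(\<lambda>k. F (p k)) \<longlonglongrightarrow> F l"
      by (auto simp: F_def case_prod_beta)
    moreover have "closed (L \<times> {-1..1::real})" using L by (intro closed_Times compact_imp_closed) auto
    ultimately have "limsup (\<lambda>k. F (p k) * indicator (L \<times> {-1..1}) (p k)) \<le> F l * indicator (L \<times> {-1..1}) l"
      using p by (intro limsup_mult_indicator_le)
    then show "limsup (\<lambda>k. ?g (?x (\<xi> k) (s k) z) * indicator {-1..1} (z \<bullet> \<xi> k))
      \<le> ?g (?x \<eta> t z) * indicator {-1..1} (z \<bullet> \<eta>)"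
      by (simp add: F_def p_def l_def indicator_times mult.assoc)
  qed
  finally show ?thesis .
qed

lemma slab_mean_bounded:
  fixes L :: "'a::euclidean_space set"
  assumes L: "compact L" and f: "continuous_on UNIV (f :: 'a \<Rightarrow> real)"
  obtains K where "0 \<le> K" "\<And>\<xi> s. norm \<xi> = 1 \<Longrightarrow> slab_mean (\<lambda>x. ennreal (f x) * indicator L x) \<xi> s \<le> ennreal K"
proof -
  obtain R C where R: "L \<subseteq> cball 0 R" and C: "\<And>x. x \<in> L \<Longrightarrow> f x \<le> C" "0 \<le> C"
    using compact_continuous_bounds[OF L f(1)] by metis
  let ?B = "cball 0 (2 * R + 1) :: 'a set"
  have "slab_mean (\<lambda>x. ennreal (f x) * indicator L x) \<xi> s \<le> ennreal (C * measure lborel ?B)" if "norm \<xi> = 1" for \<xi> s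
  proof -
    have "slab_mean (\<lambda>x. ennreal (f x) * indicator L x) \<xi> s \<le> (\<integral>\<^sup>+z. ennreal C * indicator ?B z \<partial>lborel)"
      unfolding slab_mean_def using slab_mean_integrand_bound [where f = f, OF that R C] by (intro nn_integral_mono)
    also have "\<dots> = ennreal (C * measure lborel ?B)"
      using emeasure_lborel_cball_finite[of "0::'a" "2 * R + 1"] C
      by (subst nn_integral_cmult_indicator) (auto simp: ennreal_mult emeasure_eq_ennreal_measure)
    finally show ?thesis .
  qed
  moreover have "0 \<le> C * measure lborel ?B" using C by simp
  ultimately show thesis using that by blast
qed

text \<open>An upper semicontinuous function on the compact sphere has a maximum: a maximising
  sequence of directions has a convergent subsequence, and the value at its limit is at least the
  supremum.\<close>

lemma slab_mean_attains_sup: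
  fixes L :: "'a::euclidean_space set"
  assumes L: "compact L" and f: "continuous_on UNIV f" "\<And>x. f x \<ge> 0"
  obtains \<xi> where "norm \<xi> = 1" "\<And>\<eta>. norm \<eta> = 1 \<Longrightarrow>
    slab_mean (\<lambda>x. ennreal (f x) * indicator L x) \<eta> 0 \<le> slab_mean (\<lambda>x. ennreal (f x) * indicator L x) \<xi> 0"
proof -
  let ?Q = "\<lambda>\<xi>. slab_mean (\<lambda>x. ennreal (f x) * indicator L x) \<xi> 0"
  let ?S = "Sup (?Q ` sphere 0 1)"
  obtain e :: 'a where "norm e = 1" using vector_choose_size[of 1] by auto
  then have "?Q ` sphere 0 1 \<noteq> {}" by force
  from ennreal_Sup_countable_SUP[OF this]
  obtain q where q: "incseq q" "range q \<subseteq> ?Q ` sphere 0 1" "?S = (SUP i. q i)"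
    by metis
  then have "\<forall>k. \<exists>\<xi>. norm \<xi> = 1 \<and> q k = ?Q \<xi>" by fastforce
  then obtain \<xi> where \<xi>: "\<And>k. norm (\<xi> k) = 1" "\<And>k. q k = ?Q (\<xi> k)" by metis
  obtain \<eta> r where r: "\<eta> \<in> sphere 0 1" "strict_mono r" "(\<xi> \<circ> r) \<longlonglongrightarrow> \<eta>"
    using compact_sphere[of 0 1] \<xi>(1) unfolding compact_def by (metis mem_sphere_0)
  have "(\<lambda>k. q (r k)) \<longlonglongrightarrow> ?S"
    using LIMSEQ_subseq_LIMSEQ[OF LIMSEQ_SUP[OF q(1)] r(2)] q(3) by (simp add: o_def)
  then have "(\<lambda>k. ?Q ((\<xi> \<circ> r) k)) \<longlonglongrightarrow> ?S" by (simp add: \<xi>(2))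
  then have "?S = limsup (\<lambda>k. ?Q ((\<xi> \<circ> r) k))"
    by (rule lim_imp_Limsup[OF sequentially_bot, symmetric])
  also have "\<dots> \<le> ?Q \<eta>"
    using r \<xi>(1) by (intro slab_mean_limsup assms) (auto simp: o_def)
  finally have S: "?S \<le> ?Q \<eta>" .
  show thesis
  proof (rule that[of \<eta>])
    show "?Q \<xi>' \<le> ?Q \<eta>" if "norm \<xi>' = 1" for \<xi>'
      by (rule order_trans[OF SUP_upper S]) (simp add: that)
  qed (use r(1) in simp)
qed

section \<open>The integral of the inverse norm over sets of given volume\<close>

lemma nn_integral_min_inverse_power:
  fixes n :: nat
  assumes "n \<ge> 2"
  shows "(\<integral>\<^sup>+t. ennreal (min 1 (1 / t) ^ n) * indicator {0<..} t \<partial>lborel) = ennreal (real n / (real n - 1))"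
proof -
  obtain m where n: "n = Suc (Suc m)" using assms by (metis add_2_eq_Suc le_Suc_ex)
  define F where "F t = - (1 / real (Suc m)) * (1 / t) ^ Suc m" for t :: real
  have "(\<integral>\<^sup>+t. ennreal ((1 / t) ^ n) * indicator {1..} t \<partial>lborel) = ennreal (0 - F 1)"
  proof (rule nn_integral_FTC_atLeast)
    show "DERIV F x :> (1 / x) ^ n" if "1 \<le> x" for x
    proof -
      have "DERIV (\<lambda>t. 1 / t) x :> - (1 / x) * (1 / x)"
        using that by (auto intro!: derivative_eq_intros)
      from DERIV_cmult[OF DERIV_power_Suc[OF this, of m], of "- (1 / real (Suc m))"]
      have "DERIV F x :> - (1 / real (Suc m)) * ((1 + real m) * (- (1 / x) * (1 / x) * (1 / x) ^ m))"
        by (simp add: F_def[abs_def])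
      also have "- (1 / real (Suc m)) * ((1 + real m) * (- (1 / x) * (1 / x) * (1 / x) ^ m)) = (1 / x) ^ n"
        by (simp add: n)
      finally show ?thesis .
    qed
    have "((\<lambda>t. - (1 / real (Suc m)) * (1 / t) ^ Suc m) \<longlongrightarrow> - (1 / real (Suc m)) * 0 ^ Suc m) at_top"
      by (intro tendsto_intros real_tendsto_divide_at_top[where c = 1] filterlim_ident) auto
    then show "(F \<longlongrightarrow> 0) at_top" by (simp add: F_def[abs_def])
  qed auto
  then have 1: "(\<integral>\<^sup>+t. ennreal ((1 / t) ^ n) * indicator {1..} t \<partial>lborel) = ennreal (1 / (real n - 1))"
    by (simp add: F_def n)
  \<comment> \<open>Here \<open>min 1 (1 / t)\<close> is the radius of the layer
    \<open>t * norm x \<le> 1\<close> inside the unit ball. The range below 1 contributes 1 and the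
    tail \<open>1 / (n - 1)\<close>, which together make \<open>n / (n - 1)\<close>.\<close>
  have "(\<integral>\<^sup>+t. ennreal (min 1 (1 / t) ^ n) * indicator {0<..} t \<partial>lborel) =
     (\<integral>\<^sup>+t. indicator {0<..<1} t + ennreal ((1 / t) ^ n) * indicator {1..} t \<partial>lborel)"
    by (intro nn_integral_cong) (auto simp: indicator_def min_def)
  also have "\<dots> = 1 + ennreal (1 / (real n - 1))"
    by (subst nn_integral_add) (auto simp: 1)
  also have "\<dots> = ennreal (1 + 1 / (real n - 1))"
    using assms by (simp add: ennreal_plus flip: ennreal_1)
  also have "1 + 1 / (real n - 1) = real n / (real n - 1)"
    using assms by (simp add: field_simps)
  finally show ?thesis .
qed

text \<open>Layer-cake integration. The origin is removed from the layers because \<open>1 / norm 0 = 0\<close>.\<close>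

lemma nn_integral_inverse_norm_cball:
  assumes "DIM('a::euclidean_space) \<ge> 2"
  shows "(\<integral>\<^sup>+x. ennreal (1 / norm x) * indicator (cball 0 1) x \<partial>(lborel :: 'a measure)) =
    ennreal (unit_ball_vol (DIM('a)) * (real DIM('a) / (real DIM('a) - 1)))"
proof -
  define h where "h t x = (indicator {0<..} t * indicator {x. x \<noteq> 0 \<and> t * norm x \<le> 1 \<and> norm x \<le> 1} x :: ennreal)"
    for t :: real and x :: 'a
  have [measurable]: "case_prod h \<in> borel_measurable (lborel \<Otimes>\<^sub>M lborel)"
  proof -
    have "case_prod h = indicator {p :: real \<times> 'a. fst p > 0 \<and> snd p \<noteq> 0 \<and> fst p * norm (snd p) \<le> 1 \<and> norm (snd p) \<le> 1}"
      by (auto simp: h_def fun_eq_iff indicator_def)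
    also have "\<dots> \<in> borel_measurable (borel \<Otimes>\<^sub>M borel)"
      by measurable
    finally show ?thesis by simp
  qed
  have "(\<integral>\<^sup>+x. ennreal (1 / norm x) * indicator (cball 0 1) x \<partial>(lborel :: 'a measure)) =
     (\<integral>\<^sup>+x. \<integral>\<^sup>+t. h t x \<partial>lborel \<partial>lborel)"
  proof (rule nn_integral_cong)
    fix x :: 'a
    show "ennreal (1 / norm x) * indicator (cball 0 1) x = (\<integral>\<^sup>+t. h t x \<partial>lborel)"
    proof (cases "x \<noteq> 0 \<and> norm x \<le> 1")
      case True
      then have "h t x = indicator {0<..1 / norm x} t" for t
        by (auto simp: h_def indicator_def field_simps)
      then show ?thesis using True by simp
    qed (auto simp: h_def)
  qed
  also have "\<dots> = (\<integral>\<^sup>+t. \<integral>\<^sup>+x. h t x \<partial>lborel \<partial>lborel)"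
    by (rule pair_sigma_finite.Fubini') (auto intro!: pair_sigma_finite.intro sigma_finite_lborel)
  also have "\<dots> = (\<integral>\<^sup>+t. ennreal (unit_ball_vol DIM('a)) * (ennreal (min 1 (1 / t) ^ DIM('a)) * indicator {0<..} t) \<partial>lborel)"
  proof (rule nn_integral_cong)
    fix t :: real
    show "(\<integral>\<^sup>+x. h t x \<partial>lborel) = ennreal (unit_ball_vol DIM('a)) * (ennreal (min 1 (1 / t) ^ DIM('a)) * indicator {0<..} t)"
    proof (cases "t > 0")
      case True
      have "(\<integral>\<^sup>+x. h t x \<partial>lborel) = (\<integral>\<^sup>+x. indicator (cball 0 (min 1 (1 / t))) x \<partial>(lborel :: 'a measure))"
      proof (rule nn_integral_cong_AE)
        have "AE x in (lborel :: 'a measure). x \<noteq> 0" by (rule AE_lborel_singleton)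
        then show "AE x in (lborel :: 'a measure). h t x = indicator (cball 0 (min 1 (1 / t))) x"
        proof eventually_elim
          case (elim x)
          then show ?case using True by (auto simp: h_def indicator_def field_simps)
        qed
      qed
      also have "\<dots> = ennreal (unit_ball_vol DIM('a) * min 1 (1 / t) ^ DIM('a))"
        using True by (simp add: emeasure_cball)
      finally show ?thesis using True by (simp add: ennreal_mult)
    qed (simp add: h_def)
  qed
  also have "\<dots> = ennreal (unit_ball_vol DIM('a)) * ennreal (real DIM('a) / (real DIM('a) - 1))"
    using assms by (subst nn_integral_cmult) (auto simp: nn_integral_min_inverse_power)
  also have "\<dots> = ennreal (unit_ball_vol (DIM('a)) * (real DIM('a) / (real DIM('a) - 1)))"
    using assms by (intro ennreal_mult [symmetric]) auto
  finally show ?thesis .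
qed

text \<open>Bathtub argument: \<open>F - ?B\<close> and \<open>?B - F\<close> have the same finite
  measure, while the integrand is at most 1 on the former and, off the origin, at least 1 on the
  latter.\<close>

lemma nn_integral_inverse_norm_le_cball:
  fixes F :: "'a::euclidean_space set"
  assumes [measurable]: "F \<in> sets borel" and F: "emeasure lborel F = emeasure lborel (cball 0 1 :: 'a set)"
  shows "(\<integral>\<^sup>+x. ennreal (1 / norm x) * indicator F x \<partial>lborel) \<le>
    (\<integral>\<^sup>+x. ennreal (1 / norm x) * indicator (cball 0 1 :: 'a set) x \<partial>lborel)"
proof -
  let ?B = "cball 0 1 :: 'a set"
  let ?g = "\<lambda>x::'a. ennreal (1 / norm x)"
  have split: "(\<integral>\<^sup>+x. ?g x * indicator X x \<partial>lborel) =
     (\<integral>\<^sup>+x. ?g x * indicator (X \<inter> Y) x \<partial>lborel) + (\<integral>\<^sup>+x. ?g x * indicator (X - Y) x \<partial>lborel)"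
    if [measurable]: "X \<in> sets borel" "Y \<in> sets borel" for X Y :: "'a set"
    by (subst nn_integral_add [symmetric]) (auto intro!: nn_integral_cong simp: indicator_def)
  have "(\<integral>\<^sup>+x. ?g x * indicator (F - ?B) x \<partial>lborel) \<le> (\<integral>\<^sup>+x. indicator (F - ?B) x \<partial>lborel)"
    by (intro nn_integral_mono) (auto simp: indicator_def divide_le_eq)
  also have "\<dots> = emeasure lborel (F - ?B)" by simp
  also have "\<dots> = emeasure lborel F - emeasure lborel (F \<inter> ?B)"
    using F emeasure_lborel_cball_finite[of "0::'a" 1] emeasure_mono[of "F \<inter> ?B" F lborel]
    by (subst emeasure_Diff [symmetric]) (auto simp: Diff_Int)
  also have "\<dots> = emeasure lborel (?B - F)"
    using F emeasure_lborel_cball_finite[of "0::'a" 1] emeasure_mono[of "F \<inter> ?B" F lborel]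
    unfolding F by (subst emeasure_Diff [symmetric]) (auto simp: Diff_Int)
  also have "\<dots> = (\<integral>\<^sup>+x. indicator (?B - F) x \<partial>lborel)" by simp
  also have "\<dots> \<le> (\<integral>\<^sup>+x. ?g x * indicator (?B - F) x \<partial>lborel)"
  proof (rule nn_integral_mono_AE)
    \<comment> \<open>At the origin \<open>1 / norm x\<close> takes the default value 0, so the
      lower bound 1 fails exactly there.\<close>
    have "AE x in (lborel :: 'a measure). x \<noteq> 0" by (rule AE_lborel_singleton)
    then show "AE x in lborel. indicator (?B - F) x \<le> ?g x * indicator (?B - F) x"
      by eventually_elim (auto simp: indicator_def)
  qed
  finally have le: "(\<integral>\<^sup>+x. ?g x * indicator (F - ?B) x \<partial>lborel) \<le> (\<integral>\<^sup>+x. ?g x * indicator (?B - F) x \<partial>lborel)" .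
  have "(\<integral>\<^sup>+x. ?g x * indicator F x \<partial>lborel) =
     (\<integral>\<^sup>+x. ?g x * indicator (?B \<inter> F) x \<partial>lborel) + (\<integral>\<^sup>+x. ?g x * indicator (F - ?B) x \<partial>lborel)"
    using split[of F ?B] assms(1) by (simp add: Int_commute)
  also have "\<dots> \<le> (\<integral>\<^sup>+x. ?g x * indicator (?B \<inter> F) x \<partial>lborel) + (\<integral>\<^sup>+x. ?g x * indicator (?B - F) x \<partial>lborel)"
    by (rule add_left_mono [OF le])
  also have "\<dots> = (\<integral>\<^sup>+x. ?g x * indicator ?B x \<partial>lborel)"
    by (rule split [symmetric]) (use assms(1) in auto)
  finally show ?thesis .
qed

section \<open>Averaging slab masses over an ellipsoid of directions\<close>

lemma borel_measurable_indicator_inner: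
  fixes u :: "'a::euclidean_space"
  shows "(\<lambda>x. indicator {a..b} (x \<bullet> u) :: ennreal) \<in> borel_measurable borel"
  by (rule measurable_compose[of _ _ borel]) (auto intro!: borel_measurable_continuous_onI continuous_intros)

text \<open>By Pythagoras the slab of the ball contains the cylinder of height
  \<open>2 * \<epsilon>\<close> over the ball of radius \<open>sqrt (1 - \<epsilon>\<^sup>2)\<close>
  in the hyperplane. The loss compared with the full central section disappears as
  \<open>\<epsilon>\<close> tends to 0.\<close>

lemma emeasure_slab_cball_ge:
  fixes u :: "real^'n"
  assumes "norm u = 1" "0 < \<epsilon>" "\<epsilon> < 1"
  shows "ennreal (2 * \<epsilon> * unit_ball_vol (real CARD('n) - 1) * sqrt (1 - \<epsilon>\<^sup>2) ^ (CARD('n) - 1)) \<le>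
    (\<integral>\<^sup>+x. indicator (cball 0 1) x * indicator {-\<epsilon>..\<epsilon>} (x \<bullet> u) \<partial>lborel)"
proof -
  obtain B where B: "orthonormal_basis_of (hyperplane u) B"
    using orthonormal_basis_of_exists [OF subspace_hyperplane_perp] by blast
  note o = orthonormal_basis_ofD [OF B]
  have fin [simp]: "finite B" by fact
  have card: "card B = CARD('n) - 1"
    using orthonormal_basis_of_insert_hyperplane(3)[OF B assms(1)] by simp
  let ?P = "\<Pi>\<^sub>M b\<in>B. (lborel :: real measure)"
  define r where "r = sqrt (1 - \<epsilon>\<^sup>2)"
  have "\<epsilon>\<^sup>2 < 1" using assms by (simp add: power_less_one_iff abs_square_less_1)
  then have r: "r > 0" "r\<^sup>2 = 1 - \<epsilon>\<^sup>2" by (auto simp: r_def)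
  let ?S = "{f. sqrt (\<Sum>b\<in>B. (f b)\<^sup>2) \<le> r} \<inter> space ?P"
  have [measurable]: "?S \<in> sets ?P" by measurable
  have uu: "u \<bullet> u = 1" using assms(1) by (simp add: dot_square_norm)
  have bu: "b \<bullet> u = 0" if "b \<in> B" for b
    using o(3) that span_base[of b B] by (auto simp: hyperplane_def inner_commute)
  have su: "(\<Sum>b\<in>B. y b *\<^sub>R b) \<bullet> u = 0" for y
    by (simp add: inner_sum_left bu)
  have nrm: "(norm ((\<Sum>b\<in>B. y b *\<^sub>R b) + t *\<^sub>R u))\<^sup>2 = (\<Sum>b\<in>B. (y b)\<^sup>2) + t\<^sup>2" for y t
  proof -
    have "(norm (\<Sum>b\<in>B. y b *\<^sub>R b))\<^sup>2 = (\<Sum>b\<in>B. (norm (y b *\<^sub>R b))\<^sup>2)"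
      using o(1) by (intro norm_sum_Pythagorean) (auto simp: pairwise_def orthogonal_def)
    also have "\<dots> = (\<Sum>b\<in>B. (y b)\<^sup>2)" by (simp add: o(2) power_mult_distrib)
    finally have 1: "(norm (\<Sum>b\<in>B. y b *\<^sub>R b))\<^sup>2 = (\<Sum>b\<in>B. (y b)\<^sup>2)" .
    have "(norm ((\<Sum>b\<in>B. y b *\<^sub>R b) + t *\<^sub>R u))\<^sup>2 = (norm (\<Sum>b\<in>B. y b *\<^sub>R b))\<^sup>2 + (norm (t *\<^sub>R u))\<^sup>2"
      by (rule norm_add_Pythagorean) (simp add: orthogonal_def su)
    then show ?thesis by (simp add: 1 assms(1))
  qed
  have "ennreal (2 * \<epsilon> * unit_ball_vol (real CARD('n) - 1) * r ^ (CARD('n) - 1)) =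
     emeasure ?P ?S * ennreal (2 * \<epsilon>)"
  proof -
    have "real (card B) = real CARD('n) - 1" by (simp add: card of_nat_diff)
    then have "emeasure ?P ?S = ennreal (unit_ball_vol (real CARD('n) - 1) * r ^ (CARD('n) - 1))"
      using emeasure_cball_aux[OF fin r(1)] card by simp
    moreover have "0 \<le> unit_ball_vol (real CARD('n) - 1) * r ^ (CARD('n) - 1)"
      using r by (simp add: Suc_leI)
    ultimately have "emeasure ?P ?S * ennreal (2 * \<epsilon>) = ennreal (unit_ball_vol (real CARD('n) - 1) * r ^ (CARD('n) - 1) * (2 * \<epsilon>))"
      using assms by (simp add: ennreal_mult)
    then show ?thesis by (simp add: mult_ac)
  qed
  also have "\<dots> = (\<integral>\<^sup>+y. indicator ?S y * (\<integral>\<^sup>+t. indicator {-\<epsilon>..\<epsilon>} t \<partial>lborel) \<partial>?P)"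
    using assms by (subst nn_integral_multc) auto
  also have "\<dots> = (\<integral>\<^sup>+y. \<integral>\<^sup>+t. indicator ?S y * indicator {-\<epsilon>..\<epsilon>} t \<partial>lborel \<partial>?P)"
    by (subst nn_integral_cmult) auto
  also have "\<dots> \<le> (\<integral>\<^sup>+y. \<integral>\<^sup>+t. indicator (cball 0 1) ((\<Sum>b\<in>B. y b *\<^sub>R b) + t *\<^sub>R u) *
      indicator {-\<epsilon>..\<epsilon>} (((\<Sum>b\<in>B. y b *\<^sub>R b) + t *\<^sub>R u) \<bullet> u) \<partial>lborel \<partial>?P)"
  proof (intro nn_integral_mono)
    fix y t
    show "(indicator ?S y * indicator {-\<epsilon>..\<epsilon>} t :: ennreal) \<le>
        indicator (cball 0 1) ((\<Sum>b\<in>B. y b *\<^sub>R b) + t *\<^sub>R u) *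
        indicator {-\<epsilon>..\<epsilon>} (((\<Sum>b\<in>B. y b *\<^sub>R b) + t *\<^sub>R u) \<bullet> u)"
    proof (cases "y \<in> ?S \<and> t \<in> {-\<epsilon>..\<epsilon>}")
      case True
      then have "sqrt (\<Sum>b\<in>B. (y b)\<^sup>2) \<le> r" "\<bar>t\<bar> \<le> \<epsilon>" by auto
      then have "(\<Sum>b\<in>B. (y b)\<^sup>2) \<le> r\<^sup>2" "t\<^sup>2 \<le> \<epsilon>\<^sup>2"
        using sqrt_le_D assms(2) by (auto simp: abs_le_square_iff)
      then have "(norm ((\<Sum>b\<in>B. y b *\<^sub>R b) + t *\<^sub>R u))\<^sup>2 \<le> 1" by (simp add: nrm r(2))
      then have "norm ((\<Sum>b\<in>B. y b *\<^sub>R b) + t *\<^sub>R u) \<le> 1"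
        using power2_le_imp_le[of _ 1] by simp
      then show ?thesis using True by (simp add: inner_add_left su uu)
    qed (auto simp: indicator_def)
  qed
  also have "\<dots> = (\<integral>\<^sup>+x. indicator (cball 0 1) x * indicator {-\<epsilon>..\<epsilon>} (x \<bullet> u) \<partial>lborel)"
    by (rule nn_integral_lborel_hyperplane [OF B assms(1), symmetric])
      (intro borel_measurable_times_ennreal borel_measurable_indicator_inner borel_measurable_indicator, simp)
  finally show ?thesis by (simp add: r_def)
qed

text \<open>Substituting \<open>\<eta> = A *v \<xi>\<close> preserves volume and turns
  \<open>x \<bullet> \<xi>\<close> into \<open>\<eta> \<bullet> (B *v x)\<close>. Since
  \<open>norm (B *v x) \<le> R\<close>, the condition with half-width \<open>R * \<delta>\<close> is
  implied by the one with half-width \<open>\<delta>\<close> in the unit direction of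
  \<open>B *v x\<close>.\<close>

lemma emeasure_linear_slab_ge:
  fixes A B :: "real^'n^'n"
  assumes A: "\<bar>det A\<bar> = 1" and AB: "\<And>x \<xi>. (B *v x) \<bullet> (A *v \<xi>) = x \<bullet> \<xi>"
    and x: "norm (B *v x) \<le> R" and \<delta>: "0 < \<delta>" "\<delta> < 1" and "0 < R"
  shows "ennreal (2 * \<delta> * unit_ball_vol (real CARD('n) - 1) * sqrt (1 - \<delta>\<^sup>2) ^ (CARD('n) - 1)) \<le>
    (\<integral>\<^sup>+\<xi>. indicator (cball 0 1) (A *v \<xi>) * indicator {- (R * \<delta>)..R * \<delta>} (x \<bullet> \<xi>) \<partial>lborel)"
proof -
  let ?y = "B *v x"
  have Am [measurable]: "(*v) A \<in> borel_measurable borel"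
    by (intro borel_measurable_continuous_onI linear_continuous_on) simp
  \<comment> \<open>If \<open>B *v x\<close> is zero, any unit vector serves, because every
    \<open>\<eta>\<close> then meets the condition with half-width
    \<open>R * \<delta>\<close>.\<close>
  obtain u where u: "norm u = 1" "?y = norm ?y *\<^sub>R u"
  proof (cases "?y = 0")
    case True
    obtain e :: "real^'n" where "norm e = 1" using vector_choose_size[of 1] by auto
    then show thesis using that[of e] True by simp
  next
    case False
    then show thesis using that[of "?y /\<^sub>R norm ?y"] by simp
  qed
  have "ennreal (2 * \<delta> * unit_ball_vol (real CARD('n) - 1) * sqrt (1 - \<delta>\<^sup>2) ^ (CARD('n) - 1)) \<le>
    (\<integral>\<^sup>+\<eta>. indicator (cball 0 1) \<eta> * indicator {-\<delta>..\<delta>} (\<eta> \<bullet> u) \<partial>lborel)"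
    by (rule emeasure_slab_cball_ge [OF u(1) \<delta>])
  also have "\<dots> \<le> (\<integral>\<^sup>+\<eta>. indicator (cball 0 1) \<eta> * indicator {- (R * \<delta>)..R * \<delta>} (\<eta> \<bullet> ?y) \<partial>lborel)"
  proof (intro nn_integral_mono mult_left_mono)
    fix \<eta> :: "real^'n"
    have "\<bar>\<eta> \<bullet> ?y\<bar> \<le> R * \<delta>" if "\<bar>\<eta> \<bullet> u\<bar> \<le> \<delta>"
    proof -
      have "\<eta> \<bullet> ?y = norm ?y * (\<eta> \<bullet> u)" by (subst u(2)) simp
      then have "\<bar>\<eta> \<bullet> ?y\<bar> = norm ?y * \<bar>\<eta> \<bullet> u\<bar>" by (simp add: abs_mult)
      also have "\<dots> \<le> R * \<delta>" using x that assms(6) by (intro mult_mono) auto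
      finally show ?thesis .
    qed
    then show "(indicator {-\<delta>..\<delta>} (\<eta> \<bullet> u) :: ennreal) \<le> indicator {- (R * \<delta>)..R * \<delta>} (\<eta> \<bullet> ?y)"
      by (auto simp: indicator_def abs_le_iff)
  qed auto
  also have "\<dots> = (\<integral>\<^sup>+\<eta>. indicator (cball 0 1) \<eta> * indicator {- (R * \<delta>)..R * \<delta>} (\<eta> \<bullet> ?y) \<partial>distr lborel borel ((*v) A))"
    by (simp add: distr_lborel_matrix [OF A])
  also have "\<dots> = (\<integral>\<^sup>+\<xi>. indicator (cball 0 1) (A *v \<xi>) * indicator {- (R * \<delta>)..R * \<delta>} ((A *v \<xi>) \<bullet> ?y) \<partial>lborel)"
    by (rule nn_integral_distr)
      (auto intro!: borel_measurable_times_ennreal borel_measurable_indicator_inner borel_measurable_indicator)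
  finally show ?thesis by (simp add: AB inner_commute[of "A *v _"])
qed

lemma nn_integral_slab_eq_slab_mean:
  fixes \<xi> :: "real^'n"
  assumes "\<xi> \<noteq> 0" "\<epsilon> > 0" and g: "g \<in> borel_measurable borel"
  shows "(\<integral>\<^sup>+x. g x * indicator {-\<epsilon>..\<epsilon>} (x \<bullet> \<xi>) \<partial>lborel) =
    ennreal (\<epsilon> / norm \<xi>) * slab_mean g (\<xi> /\<^sub>R norm \<xi>) (\<epsilon> / norm \<xi>)"
proof -
  have "indicator {-\<epsilon>..\<epsilon>} (x \<bullet> \<xi>) =
      (indicator {- (\<epsilon> / norm \<xi>)..\<epsilon> / norm \<xi>} (x \<bullet> (\<xi> /\<^sub>R norm \<xi>)) :: ennreal)" for x
    using assms(1) by (auto simp: indicator_def field_simps)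
  moreover have "norm (\<xi> /\<^sub>R norm \<xi>) = 1" "\<epsilon> / norm \<xi> > 0" using assms by auto
  ultimately show ?thesis by (simp add: slab_mean_pos g)
qed

text \<open>\<open>M\<close> bounds twice the central sections, which matches the factor 2 in the
  cylinder height on the left. The half-width \<open>R * \<delta> k\<close> is chosen so that every
  point of \<open>L\<close> sees a slab of the round ball of half-width at least
  \<open>\<delta> k\<close>; dividing by \<open>\<delta> k\<close> keeps both sides of order 1 in
  the limit.\<close>

lemma measure_le_sections:
  fixes A B :: "real^'n^'n" and L :: "(real^'n) set" and f :: "real^'n \<Rightarrow> real"
  assumes n: "CARD('n) \<ge> 2"
    and A: "\<bar>det A\<bar> = 1" and AB: "\<And>x \<xi>. (B *v x) \<bullet> (A *v \<xi>) = x \<bullet> \<xi>"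
    and L: "compact L" "\<And>x. x \<in> L \<Longrightarrow> norm (B *v x) \<le> R" and R: "0 < R"
    and f: "continuous_on UNIV f" "\<And>x. f x \<ge> 0"
    and G: "(\<integral>\<^sup>+x. ennreal (f x) * indicator L x \<partial>lborel) = ennreal G" "0 \<le> G"
    and M: "\<And>\<xi>. norm \<xi> = 1 \<Longrightarrow> slab_mean (\<lambda>x. ennreal (f x) * indicator L x) \<xi> 0 \<le> ennreal M" "0 \<le> M"
  shows "2 * unit_ball_vol (real CARD('n) - 1) * G \<le>
    R * M * (unit_ball_vol (real CARD('n)) * (real CARD('n) / (real CARD('n) - 1)))"
proof -
  define g where "g x = ennreal (f x) * indicator L x" for x
  define F where "F = (*v) A -` cball 0 1"
  \<comment> \<open>The shift by 2 makes \<open>\<delta> k < 1\<close> hold already at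
    \<open>k = 0\<close>.\<close>
  define \<delta> where "\<delta> k = 1 / (real k + 2)" for k :: nat
  define u where "u k \<xi> = indicator F \<xi> * (ennreal (1 / \<delta> k) *
      (\<integral>\<^sup>+x. g x * indicator {- (R * \<delta> k)..R * \<delta> k} (x \<bullet> \<xi>) \<partial>lborel))" for k \<xi>
  define I where "I = (\<integral>\<^sup>+\<xi>. ennreal (1 / norm \<xi>) * indicator F \<xi> \<partial>lborel)"
  have \<delta>: "0 < \<delta> k" "\<delta> k < 1" for k by (auto simp: \<delta>_def)
  have \<delta>_lim: "\<delta> \<longlonglongrightarrow> 0"
    using LIMSEQ_ignore_initial_segment[OF lim_1_over_n, of 2] by (simp add: \<delta>_def[abs_def] add.commute)
  have Am [measurable]: "(*v) A \<in> borel_measurable borel"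
    by (intro borel_measurable_continuous_onI linear_continuous_on) simp
  have [measurable]: "f \<in> borel_measurable borel" using f(1) by (rule borel_measurable_continuous_onI)
  have [measurable]: "L \<in> sets borel" using L(1) by (simp add: borel_compact)
  have g [measurable]: "g \<in> borel_measurable borel" by (simp add: g_def[abs_def])
  have F [measurable]: "F \<in> sets borel"
    unfolding F_def by (rule measurable_sets_borel[OF Am]) simp
  have "emeasure lborel F = emeasure (distr lborel borel ((*v) A)) (cball 0 1)"
    by (simp add: emeasure_distr F_def)
  then have eF: "emeasure lborel F = emeasure lborel (cball 0 1 :: (real^'n) set)"
    by (simp add: distr_lborel_matrix [OF A])
  have I: "I \<le> ennreal (unit_ball_vol (real CARD('n)) * (real CARD('n) / (real CARD('n) - 1)))"
    using nn_integral_inverse_norm_le_cball [OF F eF] nn_integral_inverse_norm_cball[where 'a = "real^'n"] n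
    by (simp add: I_def)
  \<comment> \<open>This crude bound, valid for all widths, supplies the majorant
    \<open>R * K / norm \<xi>\<close> on \<open>F\<close> for reverse Fatou.\<close>
  obtain K where K: "0 \<le> K" "\<And>\<xi> s. norm \<xi> = 1 \<Longrightarrow> slab_mean g \<xi> s \<le> ennreal K"
    using slab_mean_bounded [OF L(1) f(1)] unfolding g_def by metis
  have meas_pair [measurable]: "(\<lambda>(\<xi>, x). g x * indicator {-e..e} (x \<bullet> \<xi>) :: ennreal) \<in> borel_measurable (lborel \<Otimes>\<^sub>M lborel)" for e
  proof -
    have "(\<lambda>p. indicator {-e..e} (snd p \<bullet> fst p) :: ennreal) \<in> borel_measurable (lborel \<Otimes>\<^sub>M lborel)"
      by (rule measurable_compose[of _ _ borel]) auto
    then show ?thesis by (simp add: case_prod_beta')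
  qed
  have um: "u k \<in> borel_measurable lborel" for k
    unfolding u_def
    using sigma_finite_measure.borel_measurable_nn_integral[OF sigma_finite_lborel meas_pair[of "R * \<delta> k"]]
    by (intro borel_measurable_times_ennreal) auto
  have lower: "ennreal (2 * unit_ball_vol (real CARD('n) - 1) * sqrt (1 - (\<delta> k)\<^sup>2) ^ (CARD('n) - 1) * G) \<le> integral\<^sup>N lborel (u k)" for k
  proof -
    let ?e = "R * \<delta> k"
    let ?c = "ennreal (2 * \<delta> k * unit_ball_vol (real CARD('n) - 1) * sqrt (1 - (\<delta> k)\<^sup>2) ^ (CARD('n) - 1))"
    have c: "0 \<le> unit_ball_vol (real CARD('n) - 1) * sqrt (1 - (\<delta> k)\<^sup>2) ^ (CARD('n) - 1)"
      using n \<delta>[of k] by (auto simp: power_le_one_iff intro!: mult_nonneg_nonneg zero_le_power)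
    have "?c * ennreal G = (\<integral>\<^sup>+x. ?c * g x \<partial>lborel)"
      using G(1) by (subst nn_integral_cmult) (auto simp: g_def[abs_def])
    also have "\<dots> \<le> (\<integral>\<^sup>+x. \<integral>\<^sup>+\<xi>. indicator F \<xi> * (g x * indicator {- ?e..?e} (x \<bullet> \<xi>)) \<partial>lborel \<partial>lborel)"
    proof (rule nn_integral_mono)
      fix x :: "real^'n"
      show "?c * g x \<le> (\<integral>\<^sup>+\<xi>. indicator F \<xi> * (g x * indicator {- ?e..?e} (x \<bullet> \<xi>)) \<partial>lborel)"
      proof (cases "x \<in> L")
        case True
        have "?c * g x \<le> (\<integral>\<^sup>+\<xi>. indicator (cball 0 1) (A *v \<xi>) * indicator {- ?e..?e} (x \<bullet> \<xi>) \<partial>lborel) * g x"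
          by (rule mult_right_mono[OF emeasure_linear_slab_ge [OF A AB L(2)[OF True] \<delta> R]]) simp
        also have "\<dots> = (\<integral>\<^sup>+\<xi>. indicator F \<xi> * indicator {- ?e..?e} (x \<bullet> \<xi>) \<partial>lborel) * g x"
          by (simp add: F_def indicator_def)
        also have "\<dots> = (\<integral>\<^sup>+\<xi>. indicator F \<xi> * indicator {- ?e..?e} (x \<bullet> \<xi>) * g x \<partial>lborel)"
        proof (rule nn_integral_multc [symmetric])
          have "(\<lambda>\<xi>. indicator {- ?e..?e} (x \<bullet> \<xi>) :: ennreal) \<in> borel_measurable borel"
            by (subst inner_commute) (rule borel_measurable_indicator_inner)
          then show "(\<lambda>\<xi>. indicator F \<xi> * indicator {- ?e..?e} (x \<bullet> \<xi>) :: ennreal) \<in> borel_measurable lborel"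
            by simp
        qed
        also have "\<dots> = (\<integral>\<^sup>+\<xi>. indicator F \<xi> * (g x * indicator {- ?e..?e} (x \<bullet> \<xi>)) \<partial>lborel)"
          by (intro nn_integral_cong) (auto simp: F_def indicator_def)
        finally show ?thesis .
      qed (simp add: g_def)
    qed
    also have "\<dots> = (\<integral>\<^sup>+\<xi>. \<integral>\<^sup>+x. indicator F \<xi> * (g x * indicator {- ?e..?e} (x \<bullet> \<xi>)) \<partial>lborel \<partial>lborel)"
    proof (rule pair_sigma_finite.Fubini')
      show "(\<lambda>(\<xi>, x). indicator F \<xi> * (g x * indicator {- ?e..?e} (x \<bullet> \<xi>))) \<in> borel_measurable (lborel \<Otimes>\<^sub>M lborel)"
        using meas_pair[of ?e] by (simp add: case_prod_beta')
    qed (auto intro!: pair_sigma_finite.intro sigma_finite_lborel)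
    also have "\<dots> = (\<integral>\<^sup>+\<xi>. ennreal (\<delta> k) * u k \<xi> \<partial>lborel)"
    proof (rule nn_integral_cong)
      fix \<xi> :: "real^'n"
      have "ennreal (\<delta> k) * ennreal (1 / \<delta> k) = 1"
        using \<delta>[of k] by (simp flip: ennreal_mult)
      then have "ennreal (\<delta> k) * (ennreal (1 / \<delta> k) * z) = z" for z
        by (simp flip: mult.assoc)
      moreover have "(\<integral>\<^sup>+x. indicator F \<xi> * (g x * indicator {- ?e..?e} (x \<bullet> \<xi>)) \<partial>lborel) =
          indicator F \<xi> * (\<integral>\<^sup>+x. g x * indicator {- ?e..?e} (x \<bullet> \<xi>) \<partial>lborel)"
        using borel_measurable_indicator_inner[of "- ?e" ?e \<xi>] by (intro nn_integral_cmult) auto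
      ultimately show "(\<integral>\<^sup>+x. indicator F \<xi> * (g x * indicator {- ?e..?e} (x \<bullet> \<xi>)) \<partial>lborel) = ennreal (\<delta> k) * u k \<xi>"
        by (simp add: u_def indicator_def)
    qed
    also have "\<dots> = ennreal (\<delta> k) * integral\<^sup>N lborel (u k)"
      by (rule nn_integral_cmult [OF um])
    also have "?c * ennreal G = ennreal (\<delta> k) * ennreal (2 * unit_ball_vol (real CARD('n) - 1) * sqrt (1 - (\<delta> k)\<^sup>2) ^ (CARD('n) - 1) * G)"
      using c G(2) \<delta>[of k] by (simp add: mult_ac flip: ennreal_mult)
    finally show ?thesis
      using \<delta>[of k] by (simp add: ennreal_mult_le_mult_iff)
  qed
  \<comment> \<open>Normalising \<open>\<xi>\<close> divides the half-width by
    \<open>norm \<xi>\<close>. For fixed nonzero \<open>\<xi>\<close> it still tends to 0, though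
    not uniformly in \<open>\<xi>\<close>.\<close>
  have u_eq: "u k \<xi> = indicator F \<xi> * (ennreal (R / norm \<xi>) * slab_mean g (\<xi> /\<^sub>R norm \<xi>) (R * \<delta> k / norm \<xi>))"
    if "\<xi> \<noteq> 0" for k \<xi>
  proof -
    have "ennreal (1 / \<delta> k) * ennreal (R * \<delta> k / norm \<xi>) = ennreal (R / norm \<xi>)"
      using \<delta>[of k] R by (simp flip: ennreal_mult)
    then show ?thesis
      unfolding u_def using that \<delta>[of k] R g
      by (subst nn_integral_slab_eq_slab_mean) (auto simp flip: mult.assoc)
  qed
  have ae: "AE \<xi> in (lborel :: (real^'n) measure). \<xi> \<noteq> 0" by (rule AE_lborel_singleton)
  have RI: "(\<integral>\<^sup>+\<xi>. ennreal (R * c) * (ennreal (1 / norm \<xi>) * indicator F \<xi>) \<partial>lborel) = ennreal (R * c) * I" for c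
    unfolding I_def by (intro nn_integral_cmult) simp
  have conv: "indicator F \<xi> * (ennreal (R / norm \<xi>) * ennreal c) = ennreal (R * c) * (ennreal (1 / norm \<xi>) * indicator F \<xi>)"
    if "0 \<le> c" for c \<xi>
    using R that by (auto simp: indicator_def simp flip: ennreal_mult)
  have "limsup (\<lambda>k. integral\<^sup>N lborel (u k)) \<le> (\<integral>\<^sup>+\<xi>. limsup (\<lambda>k. u k \<xi>) \<partial>lborel)"
  proof (rule nn_integral_limsup)
    show "AE \<xi> in lborel. u k \<xi> \<le> ennreal (R * K) * (ennreal (1 / norm \<xi>) * indicator F \<xi>)" for k
      using ae
    proof eventually_elim
      case (elim \<xi>)
      then show ?case
        unfolding u_eq[OF elim] conv[OF K(1), symmetric] by (intro mult_left_mono K) auto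
    qed
    show "(\<integral>\<^sup>+\<xi>. ennreal (R * K) * (ennreal (1 / norm \<xi>) * indicator F \<xi>) \<partial>lborel) < \<infinity>"
      unfolding RI using I by (simp add: ennreal_mult_less_top le_less_trans)
  qed (use um in auto)
  also have "\<dots> \<le> (\<integral>\<^sup>+\<xi>. ennreal (R * M) * (ennreal (1 / norm \<xi>) * indicator F \<xi>) \<partial>lborel)"
  proof (rule nn_integral_mono_AE)
    show "AE \<xi> in lborel. limsup (\<lambda>k. u k \<xi>) \<le> ennreal (R * M) * (ennreal (1 / norm \<xi>) * indicator F \<xi>)"
      using ae
    proof eventually_elim
      case (elim \<xi>)
      let ?\<eta> = "\<xi> /\<^sub>R norm \<xi>"
      have \<eta>: "norm ?\<eta> = 1" using elim by simp
      have "(\<lambda>k. R * \<delta> k / norm \<xi>) \<longlonglongrightarrow> R * 0 / norm \<xi>" using elim by (intro tendsto_intros \<delta>_lim) auto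
      then have "limsup (\<lambda>k. slab_mean g ?\<eta> (R * \<delta> k / norm \<xi>)) \<le> slab_mean g ?\<eta> 0"
        unfolding g_def using \<eta> by (intro slab_mean_limsup L f) auto
      also have "\<dots> \<le> ennreal M" using M(1)[OF \<eta>] by (simp add: g_def[abs_def])
      finally have *: "limsup (\<lambda>k. slab_mean g ?\<eta> (R * \<delta> k / norm \<xi>)) \<le> ennreal M" .
      \<comment> \<open>Multiplication by a finite constant is continuous and monotone on
        \<open>ennreal\<close>, so it commutes with the limsup.\<close>
      have "limsup (\<lambda>k. u k \<xi>) = indicator F \<xi> * (ennreal (R / norm \<xi>) * limsup (\<lambda>k. slab_mean g ?\<eta> (R * \<delta> k / norm \<xi>)))"
        unfolding u_eq[OF elim]
        by (rule Limsup_compose_continuous_mono[of "\<lambda>z. indicator F \<xi> * (ennreal (R / norm \<xi>) * z)"])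
           (auto intro!: monoI mult_left_mono ennreal_continuous_on_cmult continuous_on_id simp: indicator_def)
      also have "\<dots> \<le> indicator F \<xi> * (ennreal (R / norm \<xi>) * ennreal M)"
        by (intro mult_left_mono *) auto
      finally show ?case unfolding conv[OF M(2)] .
    qed
  qed
  also have "\<dots> \<le> ennreal (R * M) * ennreal (unit_ball_vol (real CARD('n)) * (real CARD('n) / (real CARD('n) - 1)))"
    unfolding RI by (intro mult_left_mono I) simp
  also have "\<dots> = ennreal (R * M * (unit_ball_vol (real CARD('n)) * (real CARD('n) / (real CARD('n) - 1))))"
    using R M(2) n by (intro ennreal_mult [symmetric]) auto
  finally have upper: "limsup (\<lambda>k. integral\<^sup>N lborel (u k)) \<le>
     ennreal (R * M * (unit_ball_vol (real CARD('n)) * (real CARD('n) / (real CARD('n) - 1))))" .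
  \<comment> \<open>The cylinder radii tend to 1, which leaves the volume of the full unit ball in
    dimension \<open>n - 1\<close>.\<close>
  have "(\<lambda>k. ennreal (2 * unit_ball_vol (real CARD('n) - 1) * sqrt (1 - (\<delta> k)\<^sup>2) ^ (CARD('n) - 1) * G)) \<longlonglongrightarrow>
      ennreal (2 * unit_ball_vol (real CARD('n) - 1) * sqrt (1 - 0\<^sup>2) ^ (CARD('n) - 1) * G)"
    by (intro tendsto_intros tendsto_ennrealI \<delta>_lim)
  then have "ennreal (2 * unit_ball_vol (real CARD('n) - 1) * G) =
      limsup (\<lambda>k. ennreal (2 * unit_ball_vol (real CARD('n) - 1) * sqrt (1 - (\<delta> k)\<^sup>2) ^ (CARD('n) - 1) * G))"
    by (subst lim_imp_Limsup) auto
  also have "\<dots> \<le> limsup (\<lambda>k. integral\<^sup>N lborel (u k))"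
    using lower by (intro Limsup_mono always_eventually allI)
  also note upper
  finally show ?thesis
    using R M(2) n by (subst (asm) ennreal_le_iff) auto
qed

section \<open>Lewis ellipsoids\<close>

lemma norm_matrix_vector_mult_le: "norm (A *v x) \<le> norm A * norm x" for A :: "real^'n^'m"
proof -
  have "norm (A *v x) = L2_set (\<lambda>i. \<bar>A $ i \<bullet> x\<bar>) UNIV"
    by (simp add: norm_vec_def matrix_vector_mul_component)
  also have "\<dots> \<le> L2_set (\<lambda>i. norm (A $ i) * norm x) UNIV"
    by (intro L2_set_mono) (auto simp: Cauchy_Schwarz_ineq2)
  also have "\<dots> = norm A * norm x"
    by (simp add: norm_vec_def[of A] L2_set_left_distrib)
  finally show ?thesis .
qed

lemma powr_diff_two: "0 \<le> a \<Longrightarrow> a powr (p - 2) * a\<^sup>2 = a powr p" for a p :: real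
  by (cases "a = 0") (auto simp: powr_diff field_simps simp flip: powr_numeral)

text \<open>Young's inequality with conjugate exponents \<open>p / 2\<close> and
  \<open>p / (p - 2)\<close>. It yields the convexity estimate for the first variation and also the
  outer radius of the ellipsoid.\<close>

lemma Youngs_inequality_square_powr:
  fixes a b p :: real
  assumes "2 < p" "0 \<le> a" "0 \<le> b"
  shows "a\<^sup>2 * b powr (p - 2) \<le> 2 / p * a powr p + (1 - 2 / p) * b powr p"
proof -
  have "a\<^sup>2 * b powr (p - 2) \<le> a\<^sup>2 powr (p / 2) / (p / 2) + (b powr (p - 2)) powr (p / (p - 2)) / (p / (p - 2))"
    using assms by (intro Youngs_inequality) (auto simp: field_simps)
  also have "a\<^sup>2 powr (p / 2) = a powr p"
    using assms by (cases "a = 0") (auto simp: powr_powr simp flip: powr_numeral)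
  also have "(b powr (p - 2)) powr (p / (p - 2)) = b powr p"
    using assms by (simp add: powr_powr)
  finally show ?thesis using assms by (simp add: field_simps)
qed

text \<open>Tangent inequality for the convex function \<open>r \<mapsto> r powr (p / 2)\<close>,
  with the tangent taken at the square of \<open>b\<close>.\<close>

lemma powr_diff_le_square_diff:
  fixes a b p :: real
  assumes "2 < p" "0 \<le> a" "0 \<le> b"
  shows "b powr p - a powr p \<le> p / 2 * (b powr (p - 2) * (b\<^sup>2 - a\<^sup>2))"
proof -
  have "b powr (p - 2) * b\<^sup>2 = b powr p"
    using assms by (simp add: powr_diff_two)
  moreover have "p / 2 * (a\<^sup>2 * b powr (p - 2)) \<le> p / 2 * (2 / p * a powr p + (1 - 2 / p) * b powr p)"
    using Youngs_inequality_square_powr [OF assms] assms(1) by (intro mult_left_mono) auto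
  moreover have "p / 2 * (2 / p * a powr p + (1 - 2 / p) * b powr p) = a powr p + (p / 2 - 1) * b powr p"
    using assms(1) by (simp add: field_simps)
  ultimately show ?thesis by (simp add: algebra_simps)
qed

text \<open>The entries of \<open>w\<close> are to be the functions representing the standard basis
  vectors, so \<open>x \<bullet> w t\<close> depends exactly linearly on \<open>x\<close> at every
  \<open>t\<close>. Nondegeneracy expresses that the seminorm so defined is a norm.\<close>

locale Lp_vector =
  fixes M :: "'b measure" and w :: "'b \<Rightarrow> real^'n" and p :: real
  assumes w_meas [measurable]: "w \<in> borel_measurable M"
    and w_int: "integrable M (\<lambda>t. norm (w t) powr p)"
    and p: "2 < p"
    and nondegenerate: "\<And>x. x \<noteq> 0 \<Longrightarrow> (LINT t|M. \<bar>x \<bullet> w t\<bar> powr p) \<noteq> 0"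
begin

text \<open>The \<open>p\<close>-th power of the norm, hence homogeneous of degree \<open>p\<close>;
  its sublevel set at 1 is still the unit ball.\<close>

definition functional_norm :: "real^'n \<Rightarrow> real" where
  "functional_norm x = (LINT t|M. \<bar>x \<bullet> w t\<bar> powr p)"

definition energy :: "real^'n^'n \<Rightarrow> real" where
  "energy A = (LINT t|M. norm (A *v w t) powr p)"

lemma matrix_meas [measurable]: "(\<lambda>t. A *v w t) \<in> borel_measurable M" for A :: "real^'n^'m"
proof -
  have "(*v) A \<in> borel_measurable borel"
    by (intro borel_measurable_continuous_onI linear_continuous_on) simp
  then show ?thesis by measurable
qed

lemma dominated_integrable:
  assumes "h \<in> borel_measurable M" "\<And>t. \<bar>h t\<bar> \<le> C * norm (w t) powr p"
  shows "integrable M (h :: 'b \<Rightarrow> real)"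
  by (rule Bochner_Integration.integrable_bound [of M "\<lambda>t. C * norm (w t) powr p"])
     (use assms w_int in \<open>auto intro!: AE_I2 intro: order_trans[OF _ abs_ge_self]\<close>)

lemma dominated_convergence:
  assumes "h \<in> borel_measurable M" "\<And>k. H k \<in> borel_measurable M"
    "\<And>t. (\<lambda>k. H k t) \<longlonglongrightarrow> h t" "\<And>k t. \<bar>H k t\<bar> \<le> C * norm (w t) powr p"
  shows "(\<lambda>k. LINT t|M. H k t) \<longlonglongrightarrow> (LINT t|M. (h t :: real))"
  by (rule integral_dominated_convergence [where w = "\<lambda>t. C * norm (w t) powr p"])
     (use assms w_int in auto)

lemma norm_matrix_powr_le: "norm (A *v w t) powr p \<le> norm A powr p * norm (w t) powr p" for A :: "real^'n^'m"
  using powr_mono2[OF _ _ norm_matrix_vector_mult_le[of A "w t"], of p] p by (simp add: powr_mult)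

lemma inner_powr_le: "\<bar>x \<bullet> w t\<bar> powr p \<le> norm x powr p * norm (w t) powr p"
  using powr_mono2[OF _ _ Cauchy_Schwarz_ineq2[of x "w t"], of p] p by (simp add: powr_mult)

lemma energy_integrable: "integrable M (\<lambda>t. norm (A *v w t) powr p)" for A :: "real^'n^'m"
  by (rule dominated_integrable [of _ "norm A powr p"]) (auto simp: norm_matrix_powr_le)

lemma functional_norm_integrable: "integrable M (\<lambda>t. \<bar>x \<bullet> w t\<bar> powr p)"
  by (rule dominated_integrable [of _ "norm x powr p"]) (auto simp: inner_powr_le)

section \<open>Continuity, coercivity and minimisation of the energy\<close>

lemma powr_norm_bounded:
  fixes u :: "nat \<Rightarrow> 'v::real_normed_vector"
  assumes "u \<longlonglongrightarrow> a"
  obtains C where "\<And>n. norm (u n) powr p \<le> C"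
proof -
  obtain K where "\<And>n. norm (u n) \<le> K"
    using assms convergent_imp_Bseq[of u] by (auto simp: Bseq_def convergent_def)
  then have "norm (u n) powr p \<le> K powr p" for n
    using p by (intro powr_mono2) auto
  then show thesis by (rule that)
qed

lemma continuous_energy: "continuous_on S energy"
proof (rule continuous_on_sequentiallyI)
  fix u :: "nat \<Rightarrow> real^'n^'n" and a assume u: "u \<longlonglongrightarrow> a"
  obtain C where C: "\<And>n. norm (u n) powr p \<le> C" using powr_norm_bounded[OF u] by blast
  show "(\<lambda>n. energy (u n)) \<longlonglongrightarrow> energy a"
    unfolding energy_def
  proof (rule dominated_convergence)
    show "(\<lambda>n. norm (u n *v w t) powr p) \<longlonglongrightarrow> norm (a *v w t) powr p" for t
    proof -
      have "(\<lambda>n. u n *v w t) \<longlonglongrightarrow> a *v w t"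
        unfolding matrix_vector_mult_def
        by (intro tendsto_vec_lambda tendsto_sum tendsto_mult tendsto_vec_nth u tendsto_const)
      then show ?thesis using p by (intro tendsto_powr' tendsto_norm tendsto_const) auto
    qed
    show "\<bar>norm (u n *v w t) powr p\<bar> \<le> C * norm (w t) powr p" for n t
      using order_trans[OF norm_matrix_powr_le mult_right_mono[OF C]] by simp
  qed auto
qed

lemma continuous_functional_norm: "continuous_on S functional_norm"
proof (rule continuous_on_sequentiallyI)
  fix u :: "nat \<Rightarrow> real^'n" and a assume u: "u \<longlonglongrightarrow> a"
  obtain C where C: "\<And>n. norm (u n) powr p \<le> C" using powr_norm_bounded[OF u] by blast
  show "(\<lambda>n. functional_norm (u n)) \<longlonglongrightarrow> functional_norm a"
    unfolding functional_norm_def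
  proof (rule dominated_convergence)
    show "(\<lambda>n. \<bar>u n \<bullet> w t\<bar> powr p) \<longlonglongrightarrow> \<bar>a \<bullet> w t\<bar> powr p" for t
      using p by (intro tendsto_powr' tendsto_rabs tendsto_const tendsto_inner u) auto
    show "\<bar>\<bar>u n \<bullet> w t\<bar> powr p\<bar> \<le> C * norm (w t) powr p" for n t
      using order_trans[OF inner_powr_le mult_right_mono[OF C]] by simp
  qed auto
qed

lemma functional_norm_scaleR: "functional_norm (c *\<^sub>R x) = \<bar>c\<bar> powr p * functional_norm x"
  by (simp add: functional_norm_def abs_mult powr_mult)

lemma functional_norm_nonneg: "0 \<le> functional_norm x"
  by (simp add: functional_norm_def)

text \<open>Nondegeneracy makes the minimum over the compact sphere positive, and homogeneity
  extends the bound to all vectors. It is the source of both the coercivity of \<open>energy\<close>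
  and the boundedness of the unit ball.\<close>

lemma functional_norm_lower_bound:
  obtains \<kappa> where "\<kappa> > 0" "\<And>x. \<kappa> * norm x powr p \<le> functional_norm x"
proof -
  obtain e :: "real^'n" where e: "norm e = 1" using vector_choose_size[of 1] by auto
  then have "sphere (0 :: real^'n) 1 \<noteq> {}" by auto
  then obtain x where x: "x \<in> sphere 0 1" "\<forall>y\<in>sphere 0 1. functional_norm x \<le> functional_norm y"
    using continuous_attains_inf[OF compact_sphere _ continuous_functional_norm] by metis
  have "functional_norm x \<noteq> 0" unfolding functional_norm_def using x(1) by (intro nondegenerate) auto
  then have pos: "functional_norm x > 0" using functional_norm_nonneg[of x] by simp
  have "functional_norm x * norm y powr p \<le> functional_norm y" for y
  proof (cases "y = 0")
    case False
    have "functional_norm x \<le> functional_norm (y /\<^sub>R norm y)" using x(2) False by simp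
    then have "functional_norm x * norm y powr p \<le> functional_norm (y /\<^sub>R norm y) * norm y powr p"
      by (intro mult_right_mono) auto
    also have "\<dots> = functional_norm (norm y *\<^sub>R (y /\<^sub>R norm y))"
      by (simp only: functional_norm_scaleR[of "norm y"] abs_norm_cancel mult.commute)
    also have "norm y *\<^sub>R (y /\<^sub>R norm y) = y" using False by simp
    finally show ?thesis .
  qed (use p functional_norm_nonneg in simp)
  then show thesis using that pos by blast
qed

lemma energy_row: "functional_norm (A $ i) \<le> energy A"
  unfolding functional_norm_def energy_def
proof (rule integral_mono[OF functional_norm_integrable energy_integrable])
  fix t
  have "\<bar>A $ i \<bullet> w t\<bar> \<le> norm (A *v w t)"
    using component_le_norm_cart[of "A *v w t" i] by (simp add: matrix_vector_mul_component)
  then show "\<bar>A $ i \<bullet> w t\<bar> powr p \<le> norm (A *v w t) powr p"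
    using p by (intro powr_mono2) auto
qed

text \<open>The energy dominates \<open>functional_norm\<close> of each row, hence a multiple of the
  \<open>p\<close>-th power of the norm of that row. The matrices of determinant
  \<open>\<plusminus>1\<close> that do no worse than \<open>mat 1\<close> therefore form a compact
  set.\<close>

lemma energy_minimiser:
  obtains A where "\<bar>det A\<bar> = 1" "\<And>B. \<bar>det B\<bar> = 1 \<Longrightarrow> energy A \<le> energy B"
proof -
  obtain \<kappa> where \<kappa>: "\<kappa> > 0" "\<And>x. \<kappa> * norm x powr p \<le> functional_norm x"
    using functional_norm_lower_bound by blast
  let ?E = "energy (mat 1)"
  let ?K = "{A. \<bar>det A\<bar> = 1 \<and> energy A \<le> ?E}"
  have "norm A \<le> (\<Sum>i\<in>(UNIV::'n set). (?E / \<kappa>) powr (1 / p))" if "A \<in> ?K" for A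
  proof -
    have "norm (A $ i) \<le> (?E / \<kappa>) powr (1 / p)" for i
    proof -
      have "\<kappa> * norm (A $ i) powr p \<le> ?E"
        using \<kappa>(2)[of "A $ i"] energy_row[of A i] that by simp
      then have "norm (A $ i) powr p \<le> ?E / \<kappa>" using \<kappa>(1) by (simp add: field_simps)
      then have "(norm (A $ i) powr p) powr (1 / p) \<le> (?E / \<kappa>) powr (1 / p)"
        using p by (intro powr_mono2) auto
      then show ?thesis using p by (simp add: powr_powr)
    qed
    then have "(\<Sum>i\<in>UNIV. norm (A $ i)) \<le> (\<Sum>i\<in>(UNIV::'n set). (?E / \<kappa>) powr (1 / p))"
      by (rule sum_mono)
    moreover have "norm A \<le> (\<Sum>i\<in>UNIV. norm (A $ i))"
      unfolding norm_vec_def[of A] by (rule L2_set_le_sum) simp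
    ultimately show ?thesis by linarith
  qed
  then have "bounded ?K" unfolding bounded_iff by blast
  moreover have "closed ?K"
  proof -
    have "continuous_on UNIV (\<lambda>A::real^'n^'n. det A)"
      unfolding det_def by (intro continuous_intros)
    then show ?thesis
      by (intro closed_Collect_conj closed_Collect_eq closed_Collect_le continuous_energy continuous_intros)
  qed
  ultimately have "compact ?K" using compact_eq_bounded_closed by blast
  moreover have "mat 1 \<in> ?K" by simp
  ultimately obtain A where A: "A \<in> ?K" "\<And>B. B \<in> ?K \<Longrightarrow> energy A \<le> energy B"
    using continuous_attains_inf[OF _ _ continuous_energy, of ?K] by blast
  \<comment> \<open>A competitor outside \<open>?K\<close> exceeds the energy of
    \<open>mat 1\<close>, which is at least that of \<open>A\<close>.\<close>
  have "energy A \<le> energy B" if "\<bar>det B\<bar> = 1" for B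
    using A(1) A(2)[of B] that by (cases "B \<in> ?K") auto
  then show thesis using that A(1) by blast
qed


text \<open>First variation of the energy at a minimiser \<open>A\<close> along a curve \<open>T\<close> in the group of matrices
  of determinant \<open>\<plusminus>1\<close>; convexity of \<open>r \<mapsto> r powr (p / 2)\<close> at the perturbed point replaces
  differentiation under the integral sign.\<close>

lemma first_variation:
  fixes T :: "real \<Rightarrow> real^'n^'n" and q :: "real \<Rightarrow> real^'n \<Rightarrow> real"
  assumes A: "\<bar>det A\<bar> = 1" "\<And>B. \<bar>det B\<bar> = 1 \<Longrightarrow> energy A \<le> energy B"
    and T: "\<And>s. \<bar>s\<bar> \<le> 1/2 \<Longrightarrow> \<bar>det (T s)\<bar> = 1"
      "\<And>s v. \<bar>s\<bar> \<le> 1/2 \<Longrightarrow> (norm (T s *v v))\<^sup>2 = (norm v)\<^sup>2 + s * q s v"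
    and q: "\<And>s. q s \<in> borel_measurable borel" "\<And>s v. \<bar>s\<bar> \<le> 1/2 \<Longrightarrow> \<bar>q s v\<bar> \<le> 3 * (norm v)\<^sup>2"
      "\<And>v. ((\<lambda>s. q s v) \<longlongrightarrow> q 0 v) (at 0)"
  shows "(LINT t|M. norm (A *v w t) powr (p - 2) * q 0 (A *v w t)) = 0"
proof -
  define u where "u t = A *v w t" for t
  \<comment> \<open>For nonzero \<open>s\<close>, \<open>q s v\<close> is the difference quotient of
    the squared norm along \<open>T\<close>, and \<open>q 0 v\<close> is its limit. Thus
    \<open>p / 2 * J 0\<close> is the formal derivative of the energy at
    \<open>s = 0\<close>.\<close>
  define J where "J s = (LINT t|M. norm (T s *v u t) powr (p - 2) * q s (u t))" for s
  have [measurable]: "u \<in> borel_measurable M" by (simp add: u_def[abs_def])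
  have qm [measurable]: "(\<lambda>t. q s (u t)) \<in> borel_measurable M" for s
    using q(1) by measurable
  have T_eq: "norm (T s *v v) = sqrt ((norm v)\<^sup>2 + s * q s v)" if "\<bar>s\<bar> \<le> 1/2" for s v
    using T(2)[OF that, of v] by (metis norm_ge_zero real_sqrt_unique)
  have T_le: "norm (T s *v v) \<le> 2 * norm v" if "\<bar>s\<bar> \<le> 1/2" for s v
  proof (rule power2_le_imp_le)
    have "\<bar>s * q s v\<bar> \<le> 1/2 * (3 * (norm v)\<^sup>2)"
      unfolding abs_mult using that q(2)[OF that] by (intro mult_mono) auto
    then show "(norm (T s *v v))\<^sup>2 \<le> (2 * norm v)\<^sup>2"
      using T(2)[OF that, of v] by (simp add: power_mult_distrib)
  qed simp
  have Tm [measurable]: "(\<lambda>t. T s *v u t) \<in> borel_measurable M" for s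
    unfolding u_def matrix_vector_mul_assoc by measurable
  define C where "C = 2 powr (p - 2) * 3 * norm A powr p"
  have bound: "\<bar>norm (T s *v u t) powr (p - 2) * q s (u t)\<bar> \<le> C * norm (w t) powr p" if "\<bar>s\<bar> \<le> 1/2" for s t
  proof -
    have "\<bar>norm (T s *v u t) powr (p - 2) * q s (u t)\<bar> \<le> (2 * norm (u t)) powr (p - 2) * (3 * (norm (u t))\<^sup>2)"
      unfolding abs_mult using p that q(2)[OF that] T_le[OF that]
      by (intro mult_mono) (auto intro!: powr_mono2)
    also have "\<dots> = 2 powr (p - 2) * 3 * norm (u t) powr p"
      by (cases "u t = 0") (auto simp: powr_mult powr_diff field_simps simp flip: powr_numeral)
    also have "\<dots> \<le> 2 powr (p - 2) * 3 * (norm A powr p * norm (w t) powr p)"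
      unfolding u_def by (intro mult_left_mono norm_matrix_powr_le) auto
    finally show ?thesis by (simp add: C_def mult_ac)
  qed
  \<comment> \<open>Minimality and the tangent inequality make \<open>J\<close> nonnegative to the
    right of 0 and nonpositive to the left, so its limit \<open>J 0\<close> from both sides
    vanishes.\<close>
  have sign: "0 \<le> s * J s" if s: "\<bar>s\<bar> \<le> 1/2" for s
  proof -
    have "energy A \<le> energy (T s ** A)"
      using A T(1)[OF s] by (intro A(2)) (simp add: det_mul abs_mult)
    then have "0 \<le> (LINT t|M. norm (T s *v u t) powr p) - (LINT t|M. norm (u t) powr p)"
      by (simp add: energy_def u_def matrix_vector_mul_assoc)
    also have "\<dots> = (LINT t|M. norm (T s *v u t) powr p - norm (u t) powr p)"
      unfolding u_def matrix_vector_mul_assoc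
      by (intro Bochner_Integration.integral_diff [symmetric] energy_integrable)
    also have "\<dots> \<le> (LINT t|M. p / 2 * (s * (norm (T s *v u t) powr (p - 2) * q s (u t))))"
    proof (rule integral_mono)
      show "integrable M (\<lambda>t. norm (T s *v u t) powr p - norm (u t) powr p)"
        unfolding u_def matrix_vector_mul_assoc
        by (intro Bochner_Integration.integrable_diff energy_integrable)
      show "integrable M (\<lambda>t. p / 2 * (s * (norm (T s *v u t) powr (p - 2) * q s (u t))))"
        by (intro integrable_mult_right dominated_integrable[of _ C] bound s) measurable
      show "norm (T s *v u t) powr p - norm (u t) powr p \<le> p / 2 * (s * (norm (T s *v u t) powr (p - 2) * q s (u t)))" for t
        using powr_diff_le_square_diff[OF p, of "norm (u t)" "norm (T s *v u t)"] T(2)[OF s, of "u t"]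
        by (simp add: mult_ac)
    qed
    also have "\<dots> = p / 2 * (s * J s)" by (simp add: J_def)
    finally show ?thesis using p by (simp add: zero_le_mult_iff)
  qed
  \<comment> \<open>The sign of \<open>c\<close> selects the side of approach, and the shift by 2
    keeps the parameter within \<open>1/2\<close> of 0, where the bounds on \<open>q\<close>
    apply.\<close>
  have lim: "(\<lambda>k. J (c * (1 / (real k + 2)))) \<longlonglongrightarrow> J 0" if c: "\<bar>c\<bar> = 1" for c
  proof -
    let ?s = "\<lambda>k. c * (1 / (real k + 2))"
    have s_le: "\<bar>?s k\<bar> \<le> 1/2" for k using c by (simp add: abs_mult)
    have s_nz: "?s k \<noteq> 0" for k using c by auto
    have s0: "?s \<longlonglongrightarrow> 0"
      using tendsto_mult_right_zero[OF LIMSEQ_ignore_initial_segment[OF lim_1_over_n, of 2], of c]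
      by (simp add: add.commute)
    show ?thesis
      unfolding J_def
    proof (rule dominated_convergence[where C = C])
      fix t
      have "filterlim ?s (at 0) sequentially" using s0 s_nz by (simp add: filterlim_at)
      then have q0: "(\<lambda>k. q (?s k) (u t)) \<longlonglongrightarrow> q 0 (u t)"
        using q(3)[of "u t"] by (rule filterlim_compose[rotated])
      then have "(\<lambda>k. sqrt ((norm (u t))\<^sup>2 + ?s k * q (?s k) (u t))) \<longlonglongrightarrow> sqrt ((norm (u t))\<^sup>2 + 0 * q 0 (u t))"
        by (intro tendsto_intros s0)
      then have "(\<lambda>k. norm (T (?s k) *v u t)) \<longlonglongrightarrow> norm (T 0 *v u t)"
        using T_eq[OF s_le] T_eq[of 0 "u t"] by simp
      then show "(\<lambda>k. norm (T (?s k) *v u t) powr (p - 2) * q (?s k) (u t)) \<longlonglongrightarrow>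
          norm (T 0 *v u t) powr (p - 2) * q 0 (u t)"
        using p by (intro tendsto_mult q0 tendsto_powr' tendsto_const) auto
    qed (use bound[OF s_le] in auto)
  qed
  have "0 \<le> J 0"
  proof (rule LIMSEQ_le_const[OF lim[of 1]])
    show "\<exists>N. \<forall>k\<ge>N. 0 \<le> J (1 * (1 / (real k + 2)))"
      using sign[of "1 / (real _ + 2)"] by (simp add: zero_le_mult_iff zero_le_divide_iff)
  qed simp
  moreover have "J 0 \<le> 0"
  proof (rule LIMSEQ_le_const2[OF lim[of "-1"]])
    have "J (- 1 * (1 / (real k + 2))) \<le> 0" for k
    proof -
      have "0 \<le> (- (1 / (real k + 2))) * J (- (1 / (real k + 2)))" by (rule sign) simp
      then show ?thesis by (simp add: zero_le_mult_iff divide_le_0_iff)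
    qed
    then show "\<exists>N. \<forall>k\<ge>N. J (- 1 * (1 / (real k + 2))) \<le> 0" by blast
  qed simp
  ultimately have "J 0 = 0" by simp
  then show ?thesis using T_eq[of 0] by (simp add: J_def u_def)
qed

text \<open>Variation along shears that add \<open>s\<close> times the \<open>j\<close>-th
  coordinate to the \<open>i\<close>-th: the determinant is 1 and the squared norm has derivative
  \<open>2 * (v $ i * v $ j)\<close> at \<open>s = 0\<close>.\<close>

lemma minimiser_off_diagonal:
  assumes A: "\<bar>det A\<bar> = 1" "\<And>B. \<bar>det B\<bar> = 1 \<Longrightarrow> energy A \<le> energy B" and ij: "i \<noteq> j"
  shows "(LINT t|M. norm (A *v w t) powr (p - 2) * ((A *v w t) $ i * (A *v w t) $ j)) = 0"
proof -
  define T where "T s = (\<chi> k. if k = i then row i (mat 1) + s *s row j (mat 1) else row k (mat 1 :: real^'n^'n))" for s :: real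
  have Tv: "T s *v v = v + (s * v $ j) *\<^sub>R axis i 1" for s v
    by (simp add: vec_eq_iff matrix_vector_mul_component T_def row_def mat_def axis_def inner_vec_def
        algebra_simps sum.distrib if_distrib[of "\<lambda>x. x * _"] cong: if_cong)
       (simp add: if_distrib if_distribR sum.distrib cong: if_cong)
  have "(LINT t|M. norm (A *v w t) powr (p - 2) * (2 * ((A *v w t) $ i * (A *v w t) $ j) + 0 * ((A *v w t) $ j)\<^sup>2)) = 0"
  proof (rule first_variation[where T = T and q = "\<lambda>s v. 2 * (v $ i * v $ j) + s * (v $ j)\<^sup>2", OF A])
    show "\<bar>det (T s)\<bar> = 1" for s
      using det_row_operation[OF ij, of "mat 1 :: real^'n^'n" s] by (simp add: T_def)
    show "(norm (T s *v v))\<^sup>2 = (norm v)\<^sup>2 + s * (2 * (v $ i * v $ j) + s * (v $ j)\<^sup>2)" for s v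
      unfolding Tv power2_norm_eq_inner
      by (simp add: inner_simps inner_axis inner_axis' algebra_simps) (simp add: power2_eq_square algebra_simps)
    show "\<bar>2 * (v $ i * v $ j) + s * (v $ j)\<^sup>2\<bar> \<le> 3 * (norm v)\<^sup>2" if "\<bar>s\<bar> \<le> 1/2" for s v
    proof -
      have n: "\<bar>v $ k\<bar> \<le> norm v" for k by (rule component_le_norm_cart)
      have 1: "\<bar>v $ i * v $ j\<bar> \<le> (norm v)\<^sup>2"
        unfolding abs_mult power2_eq_square by (intro mult_mono n) auto
      have "(v $ j)\<^sup>2 \<le> (norm v)\<^sup>2" using power_mono[OF n[of j], of 2] by simp
      then have "\<bar>s * (v $ j)\<^sup>2\<bar> \<le> 1 * (norm v)\<^sup>2"
        unfolding abs_mult using that by (intro mult_mono) auto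
      then show ?thesis using 1 by linarith
    qed
    show "((\<lambda>s. 2 * (v $ i * v $ j) + s * (v $ j)\<^sup>2) \<longlongrightarrow> 2 * (v $ i * v $ j) + 0 * (v $ j)\<^sup>2) (at 0)" for v :: "real^'n"
      by (intro tendsto_intros)
  qed (auto intro!: borel_measurable_continuous_onI continuous_intros)
  then show ?thesis by (simp add: mult.left_commute[of _ 2])
qed

text \<open>Variation along diagonal matrices that stretch the \<open>i\<close>-th coordinate by
  \<open>sqrt (1 + s)\<close> and shrink the \<open>j\<close>-th by the same factor. With the square
  root the \<open>i\<close>-th contribution to the squared norm is exactly linear in
  \<open>s\<close>, so the difference quotient has a simple closed form.\<close>

lemma minimiser_diagonal:
  assumes A: "\<bar>det A\<bar> = 1" "\<And>B. \<bar>det B\<bar> = 1 \<Longrightarrow> energy A \<le> energy B" and ij: "i \<noteq> j"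
  shows "(LINT t|M. norm (A *v w t) powr (p - 2) * (((A *v w t) $ i)\<^sup>2 - ((A *v w t) $ j)\<^sup>2)) = 0"
proof -
  define d where "d s k = (if k = i then sqrt (1 + s) else if k = j then 1 / sqrt (1 + s) else 1)" for s :: real and k
  define T where "T s = (\<chi> k l. if k = l then d s k else 0 :: real^'n^'n)" for s
  have Tv: "T s *v v = (\<chi> k. d s k * v $ k)" for s v
    by (simp add: vec_eq_iff matrix_vector_mult_def T_def if_distrib[of "\<lambda>x. x * _"] cong: if_cong)
  have "(LINT t|M. norm (A *v w t) powr (p - 2) * (((A *v w t) $ i)\<^sup>2 - ((A *v w t) $ j)\<^sup>2 / (1 + 0))) = 0"
  proof (rule first_variation[where T = T and q = "\<lambda>s v. (v $ i)\<^sup>2 - (v $ j)\<^sup>2 / (1 + s)", OF A])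
    show "\<bar>det (T s)\<bar> = 1" if "\<bar>s\<bar> \<le> 1/2" for s
    proof -
      have "det (T s) = (\<Prod>k\<in>UNIV. d s k)"
        by (subst det_diagonal) (auto simp: T_def)
      also have "\<dots> = (\<Prod>k\<in>{i, j}. d s k)"
        by (intro prod.mono_neutral_right) (auto simp: d_def)
      also have "\<dots> = 1" using ij that by (auto simp: d_def)
      finally show ?thesis by simp
    qed
    show "(norm (T s *v v))\<^sup>2 = (norm v)\<^sup>2 + s * ((v $ i)\<^sup>2 - (v $ j)\<^sup>2 / (1 + s))" if "\<bar>s\<bar> \<le> 1/2" for s v
    proof -
      have "(norm (T s *v v))\<^sup>2 - (norm v)\<^sup>2 = (\<Sum>k\<in>UNIV. ((d s k)\<^sup>2 - 1) * (v $ k)\<^sup>2)"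
        by (simp add: Tv norm_vec_def L2_set_def sum_nonneg power_mult_distrib sum_subtractf left_diff_distrib)
      also have "\<dots> = (\<Sum>k\<in>{i, j}. ((d s k)\<^sup>2 - 1) * (v $ k)\<^sup>2)"
        by (intro sum.mono_neutral_right) (auto simp: d_def)
      also have "\<dots> = s * (v $ i)\<^sup>2 + (1 / (1 + s) - 1) * (v $ j)\<^sup>2"
        using ij that by (auto simp: d_def power_divide)
      also have "\<dots> = s * ((v $ i)\<^sup>2 - (v $ j)\<^sup>2 / (1 + s))"
        using that by (simp add: field_simps)
      finally show ?thesis by simp
    qed
    show "\<bar>(v $ i)\<^sup>2 - (v $ j)\<^sup>2 / (1 + s)\<bar> \<le> 3 * (norm v)\<^sup>2" if "\<bar>s\<bar> \<le> 1/2" for s v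
    proof -
      have n: "(v $ k)\<^sup>2 \<le> (norm v)\<^sup>2" for k
        using power_mono[OF component_le_norm_cart[of v k], of 2] by simp
      have s: "1 / 2 \<le> 1 + s" using that by linarith
      have "(v $ j)\<^sup>2 / (1 + s) \<le> (v $ j)\<^sup>2 / (1 / 2)"
        using s by (intro divide_left_mono) auto
      also have "\<dots> = 2 * (v $ j)\<^sup>2" by simp
      finally have "(v $ j)\<^sup>2 / (1 + s) \<le> 2 * (v $ j)\<^sup>2" .
      moreover have "0 \<le> (v $ j)\<^sup>2 / (1 + s)" using s by simp
      ultimately show ?thesis using n[of i] n[of j] zero_le_power2[of "v $ i"] by linarith
    qed
    show "((\<lambda>s. (v $ i)\<^sup>2 - (v $ j)\<^sup>2 / (1 + s)) \<longlongrightarrow> (v $ i)\<^sup>2 - (v $ j)\<^sup>2 / (1 + 0)) (at 0)" for v :: "real^'n"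
      by (intro tendsto_intros) auto
  qed (auto intro!: borel_measurable_continuous_onI borel_measurable_diff borel_measurable_divide continuous_intros)
  then show ?thesis by simp
qed

text \<open>For \<open>y = B *v x\<close> isotropy evaluates the weighted quadratic form of
  \<open>y\<close> as \<open>c * (norm y)\<^sup>2\<close>. Cauchy-Schwarz bounds the
  \<open>p\<close>-th power of the norm from above by this form, and Young's inequality bounds the
  form by that power plus a share of the energy; these are the two inclusions.\<close>

lemma lewis_ellipsoid:
  obtains A B :: "real^'n^'n" and \<rho> where "\<bar>det A\<bar> = 1" "\<bar>det B\<bar> = 1" "\<And>x \<xi>. (B *v x) \<bullet> (A *v \<xi>) = x \<bullet> \<xi>" "0 < \<rho>"
    "\<And>x. norm (B *v x) \<le> \<rho> \<Longrightarrow> functional_norm x \<le> 1"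
    "\<And>x. functional_norm x \<le> 1 \<Longrightarrow> norm (B *v x) \<le> real CARD('n) powr (1/2 - 1/p) * \<rho>"
proof -
  let ?n = "real CARD('n)"
  obtain A where A: "\<bar>det A\<bar> = 1" "\<And>B. \<bar>det B\<bar> = 1 \<Longrightarrow> energy A \<le> energy B"
    using energy_minimiser by blast
  define u where "u t = A *v w t" for t
  have [measurable]: "u \<in> borel_measurable M" by (simp add: u_def[abs_def])
  have um [measurable]: "(\<lambda>t. u t $ i) \<in> borel_measurable M" for i
    by (rule measurable_compose[of u M borel]) (auto intro!: borel_measurable_continuous_onI continuous_intros)
  have u_le: "norm (u t) powr p \<le> norm A powr p * norm (w t) powr p" for t
    unfolding u_def by (rule norm_matrix_powr_le)
  have u_split: "norm (u t) powr (p - 2) * (norm (u t))\<^sup>2 = norm (u t) powr p" for t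
    by (simp add: powr_diff_two)
  define W where "W i j t = norm (u t) powr (p - 2) * (u t $ i * u t $ j)" for i j t
  have W_int: "integrable M (W i j)" for i j
  proof (rule dominated_integrable[of _ "norm A powr p"])
    show "W i j \<in> borel_measurable M" unfolding W_def by measurable
    show "\<bar>W i j t\<bar> \<le> norm A powr p * norm (w t) powr p" for t
    proof -
      have "\<bar>u t $ i * u t $ j\<bar> \<le> (norm (u t))\<^sup>2"
        unfolding abs_mult power2_eq_square by (intro mult_mono component_le_norm_cart) auto
      then have "\<bar>W i j t\<bar> \<le> norm (u t) powr (p - 2) * (norm (u t))\<^sup>2"
        by (simp add: W_def abs_mult mult_left_mono)
      then show ?thesis using u_le[of t] u_split[of t] by linarith
    qed
  qed
  \<comment> \<open>The trace of the weighted second-moment matrix of \<open>u\<close> is the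
    energy, so this is the common value of its diagonal entries.\<close>
  define c where "c = energy A / ?n"
  have off: "integral\<^sup>L M (W i j) = 0" if "i \<noteq> j" for i j
    using minimiser_off_diagonal[OF A that] by (simp add: W_def[abs_def] u_def)
  have diag_eq: "integral\<^sup>L M (W i i) = integral\<^sup>L M (W j j)" for i j
  proof (cases "i = j")
    case False
    have "0 = (LINT t|M. W i i t - W j j t)"
      using minimiser_diagonal[OF A False] by (simp add: W_def u_def power2_eq_square right_diff_distrib)
    also have "\<dots> = integral\<^sup>L M (W i i) - integral\<^sup>L M (W j j)"
      by (intro Bochner_Integration.integral_diff W_int)
    finally show ?thesis by simp
  qed simp
  have "energy A = (LINT t|M. (\<Sum>i\<in>UNIV. W i i t))"
    unfolding energy_def
  proof (intro Bochner_Integration.integral_cong refl)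
    fix t
    have "(norm (u t))\<^sup>2 = (\<Sum>i\<in>UNIV. u t $ i * u t $ i)"
      by (simp add: power2_norm_eq_inner inner_vec_def)
    then show "norm (A *v w t) powr p = (\<Sum>i\<in>UNIV. W i i t)"
      using u_split[of t] by (simp add: W_def u_def sum_distrib_left)
  qed
  also have "\<dots> = (\<Sum>i\<in>UNIV. integral\<^sup>L M (W i i))"
    by (intro Bochner_Integration.integral_sum W_int)
  finally have E: "energy A = (\<Sum>i\<in>UNIV. integral\<^sup>L M (W i i))" .
  have diag: "integral\<^sup>L M (W i i) = c" for i
  proof -
    have "(\<Sum>k\<in>UNIV. integral\<^sup>L M (W k k)) = (\<Sum>k\<in>(UNIV::'n set). integral\<^sup>L M (W i i))"
      by (intro sum.cong diag_eq refl)
    then show ?thesis by (simp add: E c_def)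
  qed
  have quad_eq: "norm (u t) powr (p - 2) * (y \<bullet> u t)\<^sup>2 = (\<Sum>i\<in>UNIV. \<Sum>j\<in>UNIV. y $ i * y $ j * W i j t)" for y t
    by (simp add: inner_vec_def power2_eq_square sum_product W_def sum_distrib_left mult_ac)
  have quad: "(LINT t|M. norm (u t) powr (p - 2) * (y \<bullet> u t)\<^sup>2) = c * (norm y)\<^sup>2" for y
  proof -
    have "(LINT t|M. norm (u t) powr (p - 2) * (y \<bullet> u t)\<^sup>2) = (\<Sum>i\<in>UNIV. \<Sum>j\<in>UNIV. y $ i * y $ j * integral\<^sup>L M (W i j))"
      unfolding quad_eq by (simp add: W_int)
    also have "\<dots> = (\<Sum>i\<in>UNIV. \<Sum>j\<in>UNIV. if i = j then y $ i * y $ j * c else 0)"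
      by (intro sum.cong refl) (auto simp: off diag)
    also have "\<dots> = c * (norm y)\<^sup>2"
      by (simp add: power2_norm_eq_inner inner_vec_def sum_distrib_left mult_ac)
    finally show ?thesis .
  qed
  have quad_int: "integrable M (\<lambda>t. norm (u t) powr (p - 2) * (y \<bullet> u t)\<^sup>2)" for y
    unfolding quad_eq by (intro Bochner_Integration.integrable_sum integrable_mult_right W_int)
  have "invertible A" using A(1) by (auto simp: invertible_det_nz)
  then obtain A' where A': "A ** A' = mat 1" "A' ** A = mat 1" unfolding invertible_def by blast
  define B where "B = transpose A'"
  have "det A * det A' = 1" using A'(1) by (metis det_I det_mul)
  then have det_B: "\<bar>det B\<bar> = 1" using A(1) by (metis B_def abs_1 abs_mult det_transpose mult_1)
  have B: "(B *v x) \<bullet> (A *v \<xi>) = x \<bullet> \<xi>" for x \<xi>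
  proof -
    have "(B *v x) \<bullet> (A *v \<xi>) = x \<bullet> (A' *v (A *v \<xi>))"
      by (simp add: B_def dot_lmul_matrix[symmetric])
    then show ?thesis by (simp add: matrix_vector_mul_assoc A')
  qed
  have fn: "functional_norm x = (LINT t|M. \<bar>(B *v x) \<bullet> u t\<bar> powr p)" for x
    by (simp add: functional_norm_def u_def B)
  have yu_int: "integrable M (\<lambda>t. \<bar>(B *v x) \<bullet> u t\<bar> powr p)" for x
    using functional_norm_integrable[of x] by (simp add: u_def B)
  obtain i :: 'n where True by blast
  \<comment> \<open>A zero row would make the determinant vanish, so a row of \<open>A\<close> is a
    nonzero vector whose positive \<open>functional_norm\<close> lies below the energy.\<close>
  have c: "c > 0"
  proof -
    have "A $ i \<noteq> 0"
    proof
      assume "A $ i = 0"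
      then have "row i A = 0" by (simp add: row_def vec_eq_iff)
      then show False using A(1) det_zero_row(1) by fastforce
    qed
    then have "functional_norm (A $ i) \<noteq> 0"
      unfolding functional_norm_def by (rule nondegenerate)
    then have "energy A > 0" using energy_row[of A i] functional_norm_nonneg[of "A $ i"] by linarith
    then show ?thesis by (simp add: c_def)
  qed
  have upper: "functional_norm x \<le> c * norm (B *v x) powr p" for x
  proof -
    let ?y = "B *v x"
    \<comment> \<open>Cauchy-Schwarz is applied only to the factor with exponent
      \<open>p - 2\<close>; the remaining square is left for the isotropic form.\<close>
    have "functional_norm x \<le> (LINT t|M. norm ?y powr (p - 2) * (norm (u t) powr (p - 2) * (?y \<bullet> u t)\<^sup>2))"
      unfolding fn
    proof (rule integral_mono[OF yu_int integrable_mult_right[OF quad_int]])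
      fix t
      have "\<bar>?y \<bullet> u t\<bar> powr p = \<bar>?y \<bullet> u t\<bar> powr (p - 2) * (?y \<bullet> u t)\<^sup>2"
        using powr_diff_two[of "\<bar>?y \<bullet> u t\<bar>" p] by simp
      also have "\<dots> \<le> (norm ?y * norm (u t)) powr (p - 2) * (?y \<bullet> u t)\<^sup>2"
        using p by (intro mult_right_mono powr_mono2 Cauchy_Schwarz_ineq2) auto
      finally show "\<bar>?y \<bullet> u t\<bar> powr p \<le> norm ?y powr (p - 2) * (norm (u t) powr (p - 2) * (?y \<bullet> u t)\<^sup>2)"
        by (simp add: powr_mult mult_ac)
    qed
    also have "\<dots> = norm ?y powr (p - 2) * (c * (norm ?y)\<^sup>2)" by (simp add: quad)
    also have "\<dots> = c * norm ?y powr p"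
      using powr_diff_two[of "norm ?y" p] by (simp add: mult_ac)
    finally show ?thesis .
  qed
  \<comment> \<open>With \<open>s powr p\<close> equal to the energy \<open>?n * c\<close>, the two
    Young terms, weighted \<open>2 / p\<close> and \<open>1 - 2 / p\<close>, add up to exactly the
    energy on the unit ball.\<close>
  define s where "s = (?n * c) powr (1 / p)"
  have s: "s > 0" "s powr p = ?n * c" using c p by (auto simp: s_def powr_powr)
  have lower: "norm (B *v x) \<le> sqrt ?n / s" if x: "functional_norm x \<le> 1" for x
  proof -
    let ?y = "B *v x"
    have "s\<^sup>2 * (c * (norm ?y)\<^sup>2) = (LINT t|M. s\<^sup>2 * (norm (u t) powr (p - 2) * (?y \<bullet> u t)\<^sup>2))"
      by (simp add: quad)
    also have "\<dots> \<le> (LINT t|M. 2 / p * s powr p * (\<bar>?y \<bullet> u t\<bar> powr p) + (1 - 2 / p) * norm (u t) powr p)"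
    proof (rule integral_mono)
      show "s\<^sup>2 * (norm (u t) powr (p - 2) * (?y \<bullet> u t)\<^sup>2) \<le>
          2 / p * s powr p * (\<bar>?y \<bullet> u t\<bar> powr p) + (1 - 2 / p) * norm (u t) powr p" for t
        using Youngs_inequality_square_powr[OF p, of "s * \<bar>?y \<bullet> u t\<bar>" "norm (u t)"] s(1)
        by (simp add: power_mult_distrib powr_mult mult_ac)
      show "integrable M (\<lambda>t. s\<^sup>2 * (norm (u t) powr (p - 2) * (?y \<bullet> u t)\<^sup>2))"
        by (intro integrable_mult_right quad_int)
      have "integrable M (\<lambda>t. norm (u t) powr p)"
        unfolding u_def by (rule energy_integrable)
      then show "integrable M (\<lambda>t. 2 / p * s powr p * (\<bar>?y \<bullet> u t\<bar> powr p) + (1 - 2 / p) * norm (u t) powr p)"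
        by (intro Bochner_Integration.integrable_add integrable_mult_right yu_int)
    qed
    also have "\<dots> = 2 / p * s powr p * functional_norm x + (1 - 2 / p) * energy A"
      using energy_integrable[of A] yu_int by (simp add: fn energy_def u_def)
    also have "\<dots> \<le> 2 / p * s powr p * 1 + (1 - 2 / p) * energy A"
      using x p by (intro add_right_mono mult_left_mono) auto
    also have "\<dots> = ?n * c" by (simp add: s(2) c_def) (simp add: algebra_simps)
    finally have "s\<^sup>2 * (norm ?y)\<^sup>2 \<le> ?n" using c by (simp add: field_simps)
    then have "sqrt ((s * norm ?y)\<^sup>2) \<le> sqrt ?n" by (simp add: power_mult_distrib)
    then have "s * norm ?y \<le> sqrt ?n" using s(1) by (simp add: abs_mult)
    then show ?thesis using s(1) by (simp add: field_simps)
  qed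
  \<comment> \<open>The radius at which the upper bound \<open>c * norm (B *v x) powr p\<close>
    equals 1. The outer radius \<open>sqrt ?n / s\<close> then differs from it only by a power of
    the dimension.\<close>
  define \<rho> where "\<rho> = c powr (- 1 / p)"
  have "\<rho> powr p = c powr (- 1)" using p by (simp add: \<rho>_def powr_powr)
  then have \<rho>: "\<rho> > 0" "c * \<rho> powr p = 1" using c by (auto simp: \<rho>_def powr_minus_divide)
  have "sqrt ?n / s = ?n powr (1/2 - 1/p) * \<rho>"
    using c by (simp add: s_def \<rho>_def powr_mult powr_diff powr_half_sqrt powr_minus_divide)
  then have "norm (B *v x) \<le> ?n powr (1/2 - 1/p) * \<rho>" if "functional_norm x \<le> 1" for x
    using lower[OF that] by simp
  moreover have "functional_norm x \<le> 1" if "norm (B *v x) \<le> \<rho>" for x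
  proof -
    have "c * norm (B *v x) powr p \<le> c * \<rho> powr p"
      using that c p by (intro mult_left_mono powr_mono2) auto
    then show ?thesis using upper[of x] \<rho>(2) by linarith
  qed
  ultimately show thesis using that[OF A(1) det_B B \<rho>(1)] by blast
qed

lemma compact_functional_ball: "compact {x. functional_norm x \<le> 1}"
proof -
  obtain \<kappa> where \<kappa>: "\<kappa> > 0" "\<And>x. \<kappa> * norm x powr p \<le> functional_norm x"
    using functional_norm_lower_bound by blast
  have "norm x \<le> (1 / \<kappa>) powr (1 / p)" if "functional_norm x \<le> 1" for x
  proof -
    have "\<kappa> * norm x powr p \<le> 1" using \<kappa>(2)[of x] that by simp
    then have "norm x powr p \<le> 1 / \<kappa>" using \<kappa>(1) by (simp add: field_simps)
    then have "(norm x powr p) powr (1 / p) \<le> (1 / \<kappa>) powr (1 / p)"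
      using p by (intro powr_mono2) auto
    then show ?thesis using p by (simp add: powr_powr)
  qed
  then have "bounded {x. functional_norm x \<le> 1}" unfolding bounded_iff by blast
  moreover have "closed {x. functional_norm x \<le> 1}"
    by (intro closed_Collect_le continuous_functional_norm continuous_intros)
  ultimately show ?thesis using compact_eq_bounded_closed by blast
qed

end

text \<open>The embedding is linear only almost everywhere, with exceptional sets that depend on the
  vectors. Fixing representatives for the standard basis alone restores exact linearity, and each
  \<open>T x\<close> agrees with \<open>x \<bullet> w t\<close> outside a null set depending on
  \<open>x\<close>; this suffices because only integrals for fixed \<open>x\<close> are
  compared.\<close>

lemma unit_ball_of_Lp_subspace_vector:
  fixes L :: "(real^'n) set"
  assumes p: "2 < p" and L: "unit_ball_of_Lp_subspace p L"
  obtains w where "Lp_vector (lebesgue_on {0..1::real}) w p"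
    "L = {x. Lp_vector.functional_norm (lebesgue_on {0..1}) w p x \<le> 1}"
proof -
  let ?M = "lebesgue_on {0..1::real}"
  obtain N T where N: "is_norm N" "L = {x. N x \<le> 1}" and T: "\<And>x. T x \<in> Lp01 p"
    "\<And>x y. AE t in ?M. T (x + y) t = T x t + T y t"
    "\<And>a x. AE t in ?M. T (a *\<^sub>R x) t = a * T x t"
    "\<And>x. Lp01_norm p (T x) = N x"
    using L unfolding unit_ball_of_Lp_subspace_def embeds_isometrically_in_Lp01_def by (elim exE conjE) blast
  have Tm [measurable]: "T x \<in> borel_measurable ?M" for x using T(1) by (auto simp: Lp01_def)
  have Ti: "integrable ?M (\<lambda>t. \<bar>T x t\<bar> powr p)" for x using T(1) by (auto simp: Lp01_def)
  define w where "w t = (\<Sum>i\<in>UNIV. T (axis i 1) t *\<^sub>R axis i (1::real))" for t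
  have wm [measurable]: "w \<in> borel_measurable ?M"
    unfolding w_def[abs_def] by (intro borel_measurable_sum borel_measurable_scaleR Tm borel_measurable_const)
  have sum_AE: "AE t in ?M. T (\<Sum>i\<in>S. (x $ i) *\<^sub>R axis i 1) t = (\<Sum>i\<in>S. x $ i * T (axis i 1) t)"
    if "finite S" for S and x :: "real^'n"
    using that
  proof (induction S rule: finite_induct)
    case empty
    \<comment> \<open>That the chosen representative of 0 vanishes almost everywhere comes from
      homogeneity with the scalar 0.\<close>
    have "AE t in ?M. T (0 *\<^sub>R 0) t = 0 * T 0 t" by (rule T(3))
    then show ?case by simp
  next
    case (insert i S)
    have "AE t in ?M. T ((x $ i) *\<^sub>R axis i 1 + (\<Sum>i\<in>S. (x $ i) *\<^sub>R axis i 1)) t =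
       T ((x $ i) *\<^sub>R axis i 1) t + T (\<Sum>i\<in>S. (x $ i) *\<^sub>R axis i 1) t" by (rule T(2))
    with insert.IH T(3)[of "x $ i" "axis i 1"] show ?case
      by eventually_elim (use insert.hyps in simp)
  qed
  have xw: "x \<bullet> w t = (\<Sum>i\<in>UNIV. x $ i * T (axis i 1) t)" for x t
    by (simp add: w_def inner_sum_right inner_axis mult.commute)
  have T_AE: "AE t in ?M. T x t = x \<bullet> w t" for x
  proof -
    have "(\<Sum>i\<in>UNIV. (x $ i) *\<^sub>R axis i 1) = x"
      by (simp add: vec_eq_iff axis_def if_distrib cong: if_cong)
    then show ?thesis using sum_AE[of UNIV x] by (simp add: xw)
  qed
  have fn: "(LINT t|?M. \<bar>x \<bullet> w t\<bar> powr p) = (LINT t|?M. \<bar>T x t\<bar> powr p)" for x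
  proof (rule integral_cong_AE)
    show "AE t in ?M. \<bar>x \<bullet> w t\<bar> powr p = \<bar>T x t\<bar> powr p"
      using T_AE[of x] by eventually_elim simp
  qed measurable
  have N_eq: "N x = (LINT t|?M. \<bar>x \<bullet> w t\<bar> powr p) powr (1 / p)" for x
    by (simp add: T(4)[symmetric] Lp01_norm_def fn)
  have w_int: "integrable ?M (\<lambda>t. norm (w t) powr p)"
  proof (rule Bochner_Integration.integrable_bound)
    show "integrable ?M (\<lambda>t. real CARD('n) powr p * (\<Sum>i\<in>UNIV. \<bar>T (axis i (1::real) :: real^'n) t\<bar> powr p))"
      by (intro integrable_mult_right Bochner_Integration.integrable_sum Ti)
    show "AE t in ?M. norm (norm (w t) powr p) \<le> norm (real CARD('n) powr p * (\<Sum>i\<in>UNIV. \<bar>T (axis i (1::real) :: real^'n) t\<bar> powr p))"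
    proof (rule AE_I2)
      fix t
      let ?a = "\<lambda>i. \<bar>T (axis i (1::real) :: real^'n) t\<bar>"
      \<comment> \<open>The \<open>p\<close>-th power of a sum is at most
        \<open>CARD('n) powr p\<close> times that of its largest term, which is itself one of the
        summands of the majorant.\<close>
      define m where "m = Max (range ?a)"
      have "norm (w t) \<le> (\<Sum>i\<in>UNIV. ?a i)"
        unfolding w_def by (rule order_trans[OF norm_sum]) (simp add: norm_axis_1)
      also have "\<dots> \<le> (\<Sum>i\<in>(UNIV::'n set). m)"
        unfolding m_def by (intro sum_mono Max_ge) auto
      also have "\<dots> = real CARD('n) * m" by simp
      finally have "norm (w t) powr p \<le> (real CARD('n) * m) powr p"
        using p by (intro powr_mono2) auto
      also have "m \<in> range ?a" unfolding m_def by (rule Max_in) auto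
      then obtain i where i: "m = ?a i" by auto
      have "(real CARD('n) * m) powr p = real CARD('n) powr p * ?a i powr p"
        by (simp add: i powr_mult)
      also have "\<dots> \<le> real CARD('n) powr p * (\<Sum>i\<in>UNIV. ?a i powr p)"
        by (intro mult_left_mono member_le_sum) auto
      finally show "norm (norm (w t) powr p) \<le> norm (real CARD('n) powr p * (\<Sum>i\<in>UNIV. ?a i powr p))"
        by (simp add: sum_nonneg)
    qed
  qed measurable
  have lp: "Lp_vector ?M w p"
  proof
    fix x :: "real^'n" assume "x \<noteq> 0"
    then have "N x \<noteq> 0" using N(1) by (auto simp: is_norm_def)
    then show "(LINT t|?M. \<bar>x \<bullet> w t\<bar> powr p) \<noteq> 0" unfolding N_eq by auto
  qed (use p wm w_int in auto)
  have "N x \<le> 1 \<longleftrightarrow> Lp_vector.functional_norm ?M w p x \<le> 1" for x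
  proof -
    let ?I = "LINT t|?M. \<bar>x \<bullet> w t\<bar> powr p"
    have "?I powr (1 / p) \<le> 1 \<longleftrightarrow> ?I \<le> 1"
    proof
      assume "?I powr (1 / p) \<le> 1"
      then have "(?I powr (1 / p)) powr p \<le> 1 powr p" using p by (intro powr_mono2) auto
      then show "?I \<le> 1" using p by (simp add: powr_powr)
    next
      assume "?I \<le> 1"
      then have "?I powr (1 / p) \<le> 1 powr (1 / p)" using p by (intro powr_mono2) auto
      then show "?I powr (1 / p) \<le> 1" by simp
    qed
    then show ?thesis by (simp add: N_eq Lp_vector.functional_norm_def[OF lp])
  qed
  then show thesis using that[OF lp] N(2) by simp
qed

section \<open>The slicing inequality\<close>

text \<open>Bridge from the nonnegative integrals used for semicontinuity to the real-valued section
  in the theorem.\<close>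

lemma dens_section_eq_slab_mean:
  fixes \<xi> :: "real^'n" and L :: "(real^'n) set"
  assumes \<xi>: "norm \<xi> = 1" and L: "compact L" and f: "continuous_on UNIV f" "\<And>x. f x \<ge> 0"
  shows "slab_mean (\<lambda>x. ennreal (f x) * indicator L x) \<xi> 0 = ennreal (2 * dens_section f L \<xi>)"
proof -
  let ?H = "hyperplane \<xi>"
  have [measurable]: "f \<in> borel_measurable borel" using f(1) by (rule borel_measurable_continuous_onI)
  have [measurable]: "L \<in> sets borel" using L by (simp add: borel_compact)
  have [measurable]: "?H \<in> sets borel"
    unfolding hyperplane_def by (intro borel_closed closed_hyperplane)
  have xi: "\<xi> \<bullet> \<xi> = 1" using \<xi> by (simp add: dot_square_norm)
  define X where "X = (\<integral>\<^sup>+x. ennreal (f x) * indicator (L \<inter> ?H) x \<partial>subspace_lborel ?H)"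
  have "slab_mean (\<lambda>x. ennreal (f x) * indicator L x) \<xi> 0 = slab_mean (\<lambda>x. ennreal (f x) * indicator (L \<inter> ?H) x) \<xi> 0"
    unfolding slab_mean_def
  proof (rule nn_integral_cong)
    fix z :: "real^'n"
    \<comment> \<open>At width 0 the evaluation point is the orthogonal projection of
      \<open>z\<close>, so restricting \<open>L\<close> to the hyperplane leaves the integrand
      unchanged.\<close>
    have "z + ((0 - 1) * (z \<bullet> \<xi>)) *\<^sub>R \<xi> \<in> ?H"
      by (simp add: hyperplane_def inner_diff_right xi inner_commute)
    then show "ennreal (f (z + ((0 - 1) * (z \<bullet> \<xi>)) *\<^sub>R \<xi>)) * indicator L (z + ((0 - 1) * (z \<bullet> \<xi>)) *\<^sub>R \<xi>) * indicator {-1..1} (z \<bullet> \<xi>) =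
      ennreal (f (z + ((0 - 1) * (z \<bullet> \<xi>)) *\<^sub>R \<xi>)) * indicator (L \<inter> ?H) (z + ((0 - 1) * (z \<bullet> \<xi>)) *\<^sub>R \<xi>) * indicator {-1..1} (z \<bullet> \<xi>)"
      by (simp add: indicator_def)
  qed
  also have "\<dots> = 2 * X"
    unfolding X_def by (rule slab_mean_zero [OF \<xi>]) measurable
  finally have eq: "slab_mean (\<lambda>x. ennreal (f x) * indicator L x) \<xi> 0 = 2 * X" .
  obtain K where "slab_mean (\<lambda>x. ennreal (f x) * indicator L x) \<xi> 0 \<le> ennreal K"
    using slab_mean_bounded [OF L f(1)] \<xi> by metis
  \<comment> \<open>Finiteness is what lets \<open>enn2real\<close> be inverted; an infinite
    integral would be sent to 0.\<close>
  then have "X < top" unfolding eq by (auto simp: ennreal_mult_eq_top_iff less_top[symmetric] top_unique)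
  have sets: "sets (subspace_lborel ?H) = sets borel"
    by (simp add: subspace_lborel_def Let_def)
  have "dens_section f L \<xi> = enn2real (\<integral>\<^sup>+x. ennreal (indicator (L \<inter> ?H) x *\<^sub>R f x) \<partial>subspace_lborel ?H)"
    unfolding dens_section_def set_lebesgue_integral_def
    by (rule integral_eq_nn_integral) (auto simp: f(2) measurable_cong_sets[OF sets refl])
  also have "\<dots> = enn2real X"
    unfolding X_def by (intro arg_cong[where f = enn2real] nn_integral_cong) (auto simp: indicator_def)
  finally have "X = ennreal (dens_section f L \<xi>)" using \<open>X < top\<close> by simp
  moreover have "0 \<le> dens_section f L \<xi>"
    unfolding dens_section_def set_lebesgue_integral_def by (intro integral_nonneg_AE) (simp add: f(2))
  ultimately show ?thesis unfolding eq by (simp add: ennreal_mult)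
qed

theorem corollary3:
  fixes p :: real and L :: "(real ^ 'n) set" and f :: "real ^ 'n \<Rightarrow> real"
  assumes "CARD('n) \<ge> 2"
    and "2 < p"
    and "unit_ball_of_Lp_subspace p L"
    and "continuous_on UNIV f" and "\<And>x. f x \<ge> 0" and "\<And>x. f (- x) = f x"
  shows "\<exists>\<xi>. is_arg_max (dens_section f L) (\<lambda>\<xi>. \<xi> \<in> sphere 0 1) \<xi> \<and>
           dens_measure f L
             \<le> real CARD('n) powr (1/2 - 1/p) * (real CARD('n) / (real CARD('n) - 1))
                * ball_const CARD('n) * dens_section f L \<xi>
                * measure lborel L powr (1 / real CARD('n))"
proof -
  let ?n = "real CARD('n)"
  let ?g = "\<lambda>x. ennreal (f x) * indicator L x"
  note f = assms(4,5)
  obtain w where w: "Lp_vector (lebesgue_on {0..1::real}) w p"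
    and L_eq: "L = {x. Lp_vector.functional_norm (lebesgue_on {0..1}) w p x \<le> 1}"
    using unit_ball_of_Lp_subspace_vector [OF assms(2,3)] .
  interpret Lp_vector "lebesgue_on {0..1::real}" w p by fact
  have L: "compact L" unfolding L_eq by (rule compact_functional_ball)
  have L_meas [measurable]: "L \<in> sets borel" using L by (simp add: borel_compact)
  obtain A B \<rho> where A: "\<bar>det A\<bar> = 1" and B: "\<bar>det B\<bar> = 1"
    and AB: "\<And>x \<xi>. (B *v x) \<bullet> (A *v \<xi>) = x \<bullet> \<xi>" and \<rho>: "0 < \<rho>"
    and inner: "\<And>x. norm (B *v x) \<le> \<rho> \<Longrightarrow> x \<in> L"
    and outer: "\<And>x. x \<in> L \<Longrightarrow> norm (B *v x) \<le> ?n powr (1/2 - 1/p) * \<rho>"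
    using lewis_ellipsoid unfolding L_eq mem_Collect_eq by metis
  \<comment> \<open>The maximal section is found among slab means of width 0, which are twice the
    sections and hence have the same maximising directions.\<close>
  obtain \<xi> where \<xi>: "norm \<xi> = 1" and max: "\<And>\<eta>. norm \<eta> = 1 \<Longrightarrow> slab_mean ?g \<eta> 0 \<le> slab_mean ?g \<xi> 0"
    using slab_mean_attains_sup [OF L f] by blast
  have D_nonneg: "0 \<le> dens_section f L \<eta>" for \<eta>
    unfolding dens_section_def set_lebesgue_integral_def by (intro integral_nonneg_AE) (simp add: f(2))
  have D_max: "dens_section f L \<eta> \<le> dens_section f L \<xi>" if "norm \<eta> = 1" for \<eta>
    using max[OF that] D_nonneg
    by (simp add: dens_section_eq_slab_mean[OF that L f] dens_section_eq_slab_mean[OF \<xi> L f])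
  define D where "D = dens_section f L \<xi>"
  define G where "G = dens_measure f L"
  have "integrable lborel (\<lambda>x. indicator L x *\<^sub>R f x)"
    using L f(1) by (intro borel_integrable_compact) (auto intro: continuous_on_subset)
  then have "(\<integral>\<^sup>+x. ennreal (indicator L x *\<^sub>R f x) \<partial>lborel) = ennreal G"
    unfolding G_def dens_measure_def set_lebesgue_integral_def
    by (rule nn_integral_eq_integral) (simp add: f(2))
  also have "(\<integral>\<^sup>+x. ennreal (indicator L x *\<^sub>R f x) \<partial>lborel) = (\<integral>\<^sup>+x. ?g x \<partial>lborel)"
    by (intro nn_integral_cong) (auto simp: indicator_def)
  finally have G: "(\<integral>\<^sup>+x. ?g x \<partial>lborel) = ennreal G" .
  have "0 \<le> G"
    unfolding G_def dens_measure_def set_lebesgue_integral_def by (intro integral_nonneg_AE) (simp add: f(2))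
  define a where "a = ?n powr (1/2 - 1/p)"
  define \<omega> where "\<omega> = unit_ball_vol ?n"
  define \<omega>' where "\<omega>' = unit_ball_vol (?n - 1)"
  have \<omega>: "\<omega> > 0" "\<omega>' > 0" using assms(1) by (auto simp: \<omega>_def \<omega>'_def)
  have a: "a > 0" by (simp add: a_def)
  \<comment> \<open>The averaging bound is applied with the outer radius \<open>a * \<rho>\<close>
    and with \<open>2 * D\<close> as the bound for slab means; the factors 2 cancel.\<close>
  have "2 * \<omega>' * G \<le> a * \<rho> * (2 * D) * (\<omega> * (?n / (?n - 1)))"
    unfolding \<omega>_def \<omega>'_def
  proof (rule measure_le_sections [OF assms(1) A AB L _ _ f G \<open>0 \<le> G\<close>])
    show "norm (B *v x) \<le> a * \<rho>" if "x \<in> L" for x using outer[OF that] by (simp add: a_def)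
    show "0 < a * \<rho>" using a \<rho> by simp
    show "slab_mean ?g \<eta> 0 \<le> ennreal (2 * D)" if "norm \<eta> = 1" for \<eta>
      using max[OF that] by (simp add: D_def dens_section_eq_slab_mean[OF \<xi> L f])
    show "0 \<le> 2 * D" using D_nonneg by (simp add: D_def)
  qed
  also have "a * \<rho> * (2 * D) * (\<omega> * (?n / (?n - 1))) = 2 * \<omega>' * (a * (?n / (?n - 1)) * (\<omega> / \<omega>') * D * \<rho>)"
    using \<omega>(2) by (simp add: mult_ac)
  finally have "G \<le> a * (?n / (?n - 1)) * (\<omega> / \<omega>') * D * \<rho>"
    by (rule mult_left_le_imp_le) (use \<omega>(2) in simp)
  also have "\<dots> \<le> a * (?n / (?n - 1)) * ball_const CARD('n) * D * measure lborel L powr (1 / ?n)"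
  proof -
    have Bm [measurable]: "(*v) B \<in> borel_measurable borel"
      by (intro borel_measurable_continuous_onI linear_continuous_on) simp
    \<comment> \<open>Since \<open>\<bar>det B\<bar> = 1\<close>, the inscribed ellipsoid has the
      volume of a ball of radius \<open>\<rho>\<close>, which bounds \<open>\<rho>\<close> by the
      volume of \<open>L\<close>.\<close>
    have "ennreal (\<omega> * \<rho> ^ CARD('n)) = emeasure (distr lborel borel ((*v) B)) (cball 0 \<rho>)"
      using \<rho> by (simp add: distr_lborel_matrix [OF B] emeasure_cball \<omega>_def)
    also have "\<dots> = emeasure lborel ((*v) B -` cball 0 \<rho>)"
      by (simp add: emeasure_distr)
    also have "\<dots> \<le> emeasure lborel L"
      using inner by (intro emeasure_mono) auto
    also have "\<dots> = ennreal (measure lborel L)"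
      using emeasure_compact_finite[OF L] by (intro emeasure_eq_ennreal_measure) auto
    finally have "\<omega> * \<rho> ^ CARD('n) \<le> measure lborel L"
      by simp
    then have "(\<omega> * \<rho> ^ CARD('n)) powr (1 / ?n) \<le> measure lborel L powr (1 / ?n)"
      using \<omega> \<rho> by (intro powr_mono2) auto
    moreover have "(\<omega> * \<rho> ^ CARD('n)) powr (1 / ?n) = \<omega> powr (1 / ?n) * \<rho>"
      using \<omega> \<rho> by (simp add: powr_mult powr_powr flip: powr_realpow)
    ultimately have "\<omega> powr (1 / ?n) * \<rho> \<le> measure lborel L powr (1 / ?n)" by simp
    then have "ball_const CARD('n) * (\<omega> powr (1 / ?n) * \<rho>) \<le> ball_const CARD('n) * measure lborel L powr (1 / ?n)"
      using \<omega>(2) by (intro mult_left_mono) (auto simp: ball_const_def \<omega>'_def)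
    \<comment> \<open>The exponents \<open>(n - 1) / n\<close> and \<open>1 / n\<close> add up to 1;
      this is why \<open>ball_const\<close> carries the former.\<close>
    moreover have "ball_const CARD('n) * \<omega> powr (1 / ?n) = \<omega> / \<omega>'"
    proof -
      have "\<omega> powr ((?n - 1) / ?n) * \<omega> powr (1 / ?n) = \<omega>"
        using \<omega>(1) by (simp add: diff_divide_distrib flip: powr_add)
      then show ?thesis by (simp add: ball_const_def \<omega>_def \<omega>'_def)
    qed
    ultimately have le: "\<omega> / \<omega>' * \<rho> \<le> ball_const CARD('n) * measure lborel L powr (1 / ?n)"
      by (simp add: mult.assoc[symmetric])
    have "0 \<le> a * (?n / (?n - 1)) * D"
      using a D_nonneg assms(1) by (auto simp: D_def)
    from mult_left_mono[OF le this] show ?thesis by (simp add: mult_ac)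
  qed
  finally show ?thesis
    using \<xi> D_max by (intro exI[of _ \<xi>]) (auto simp: is_arg_max_def not_less a_def D_def G_def)
qed

end
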